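(* Suppose that $n\geq 2$ and $2\leq p_1\leq\cdots\leq p_n$. Let $$q=p_1p_2\cdots p_n-(p_1+p_2+\cdots+p_n)+n.$$ If $q\leq p_{n+1}\leq p_1p_2\cdots p_n$, then $p_{n+1}$ is the smallest typical rank of $p_1\times\cdots\times p_{n+1}$ tensors over $\mathbb{R}$, and $(p_1,\ldots,p_{n+1})$ is perfect. Conversely, if $(p_1,\ldots,p_{n+1})$ is perfect, then $q\leq p_{n+1}\leq p_1p_2\cdots p_n$.
   Context: All $p_i$ are positive integers. For positive integers $p_1,\ldots,p_m$, a $p_1\times\cdots\times p_m$ tensor over $\mathbb{R}$ is an element of $T(p_1,\ldots,p_m;\mathbb{R})=\mathbb{R}^{p_1}\otimes\cdots\otimes\mathbb{R}^{p_m}$, which is identified with $\mathbb{R}^{p_1\cdots p_m}$ (with its Euclidean topology and Lebesgue measure). The rank of a tensor $T$ is the minimum number $r$ such that $T$ is a sum of $r$ tensors of the form $a_1\otimes\cdots\otimes a_m$ with $a_i\in\mathbb{R}^{p_i}$. An integer $r$ is called a typical rank of $p_1\times\cdots\times p_m$ tensors (over $\mathbb{R}$) if the set of tensors of rank $r$ has positive Lebesgue measure in $T(p_1,\ldots,p_m;\mathbb{R})$; there may be more than one typical rank. A format $(p_1,\ldots,p_m)$ is called perfect if $\max(p_1,\ldots,p_m)$ is a typical rank of $T(p_1,\ldots,p_m;\mathbb{R})$.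
   Formalization: The converse is proved under the added assumption p_n ≤ p_{n+1}; without it it fails, e.g. (2,3,2) is perfect (3 is a typical rank of 2×2×3 tensors) but q = 3 > 2 = p_3. *)

theory Defs
  imports "HOL-Analysis.Analysis"
begin

text \<open>A format \<open>(p\<^sub>1, \<dots>, p\<^sub>m)\<close> is given by \<open>m\<close> and a function \<open>p\<close>, of which only the values
  \<open>p 1, \<dots>, p m\<close> matter. A tensor is its coordinate array with respect to the standard bases, that
  is, a function on the set of multi-indices, extended by \<open>undefined\<close> outside that set. This is the
  identification of the tensor space with Euclidean space of dimension \<open>p\<^sub>1 \<cdots> p\<^sub>m\<close>.\<close>

definition multi_indices :: "nat \<Rightarrow> (nat \<Rightarrow> nat) \<Rightarrow> (nat \<Rightarrow> nat) set" where
  "multi_indices m p = (\<Pi>\<^sub>E i\<in>{1..m}. {1..p i})"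

definition tensor_space :: "nat \<Rightarrow> (nat \<Rightarrow> nat) \<Rightarrow> ((nat \<Rightarrow> nat) \<Rightarrow> real) set" where
  "tensor_space m p = (\<Pi>\<^sub>E j\<in>multi_indices m p. UNIV)"

definition tensor_lebesgue :: "nat \<Rightarrow> (nat \<Rightarrow> nat) \<Rightarrow> ((nat \<Rightarrow> nat) \<Rightarrow> real) measure" where
  "tensor_lebesgue m p = completion (\<Pi>\<^sub>M j\<in>multi_indices m p. lborel)"

lemma space_tensor_lebesgue: "space (tensor_lebesgue m p) = tensor_space m p"
  by (simp add: tensor_lebesgue_def tensor_space_def space_PiM)

text \<open>The tensor \<open>a\<^sub>1 \<otimes> \<cdots> \<otimes> a\<^sub>m\<close>, where the \<open>k\<close>-th coordinate of the vector \<open>a\<^sub>i\<close> is \<open>a i k\<close>; only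
  the coordinates with \<open>1 \<le> k \<le> p i\<close> are used.\<close>

definition simple_tensor ::
  "nat \<Rightarrow> (nat \<Rightarrow> nat) \<Rightarrow> (nat \<Rightarrow> nat \<Rightarrow> real) \<Rightarrow> (nat \<Rightarrow> nat) \<Rightarrow> real" where
  "simple_tensor m p a = (\<lambda>j\<in>multi_indices m p. \<Prod>i=1..m. a i (j i))"

definition sum_of_simple_tensors ::
  "nat \<Rightarrow> (nat \<Rightarrow> nat) \<Rightarrow> nat \<Rightarrow> ((nat \<Rightarrow> nat) \<Rightarrow> real) \<Rightarrow> bool" where
  "sum_of_simple_tensors m p r T \<longleftrightarrow>
     (\<exists>a :: nat \<Rightarrow> nat \<Rightarrow> nat \<Rightarrow> real.
        T = (\<lambda>j\<in>multi_indices m p. \<Sum>k<r. simple_tensor m p (a k) j))"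

definition tensor_rank ::
  "nat \<Rightarrow> (nat \<Rightarrow> nat) \<Rightarrow> ((nat \<Rightarrow> nat) \<Rightarrow> real) \<Rightarrow> nat" where
  "tensor_rank m p T = (LEAST r. sum_of_simple_tensors m p r T)"

text \<open>For \<open>m \<ge> 1\<close> the minimum defining the rank is taken over a nonempty set.\<close>

lemma ex_sum_of_simple_tensors:
  assumes "1 \<le> m" "T \<in> tensor_space m p"
  shows "\<exists>r. sum_of_simple_tensors m p r T"
proof -
  let ?I = "multi_indices m p"
  have fin: "finite ?I"
    unfolding multi_indices_def by (intro finite_PiE) auto
  then obtain h where h: "bij_betw h {..<card ?I} ?I"
    using ex_bij_betw_nat_finite[OF fin] by (auto simp: lessThan_atLeast0)
  define b where
    "b J i k = (if k = J i then if i = 1 then T J else 1 else 0)" for J :: "nat \<Rightarrow> nat" and i k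
  have b: "simple_tensor m p (b J) j = (if J = j then T j else 0)" if J: "J \<in> ?I" and j: "j \<in> ?I" for J j
  proof (cases "J = j")
    case True
    have "(\<Prod>i=1..m. b J i (j i)) = (\<Prod>i=1..m. if i = 1 then T J else 1)"
      using True by (simp add: b_def)
    also have "\<dots> = T J"
      using assms(1) by (subst prod.delta) auto
    finally show ?thesis
      using True j by (simp add: simple_tensor_def)
  next
    case False
    then obtain i where i: "i \<in> {1..m}" "J i \<noteq> j i"
      using J j PiE_ext[of J "{1..m}" "\<lambda>i. {1..p i}" j] unfolding multi_indices_def by blast
    have "b J i (j i) = 0"
      using i(2) by (simp add: b_def)
    with i(1) have "(\<Prod>i=1..m. b J i (j i)) = 0"
      by (intro prod_zero) auto
    then show ?thesis
      using False j by (simp add: simple_tensor_def)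
  qed
  have "T j = (\<Sum>k<card ?I. simple_tensor m p (b (h k)) j)" if "j \<in> ?I" for j
  proof -
    have "(\<Sum>k<card ?I. simple_tensor m p (b (h k)) j) = (\<Sum>J\<in>?I. simple_tensor m p (b J) j)"
      by (rule sum.reindex_bij_betw[OF h])
    also have "\<dots> = (\<Sum>J\<in>?I. if J = j then T j else 0)"
      using b that by (intro sum.cong) auto
    also have "\<dots> = T j"
      using fin that by simp
    finally show ?thesis ..
  qed
  then have "T = (\<lambda>j\<in>?I. \<Sum>k<card ?I. simple_tensor m p (b (h k)) j)"
    using assms(2) unfolding tensor_space_def by (intro extensionalityI[of T ?I]) (auto simp: PiE_iff)
  then show ?thesis
    unfolding sum_of_simple_tensors_def
    by (intro exI[of _ "card ?I"] exI[of _ "\<lambda>k. b (h k)"])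
qed

text \<open>The set of tensors of rank at most \<open>r\<close> is a continuous image of a Euclidean space, hence Borel,
  so the convention that non-measurable sets have \<open>emeasure\<close> zero plays no role here.\<close>

definition typical_rank :: "nat \<Rightarrow> (nat \<Rightarrow> nat) \<Rightarrow> nat \<Rightarrow> bool" where
  "typical_rank m p r \<longleftrightarrow>
     0 < emeasure (tensor_lebesgue m p) {T \<in> tensor_space m p. tensor_rank m p T = r}"

definition perfect_format :: "nat \<Rightarrow> (nat \<Rightarrow> nat) \<Rightarrow> bool" where
  "perfect_format m p \<longleftrightarrow> typical_rank m p (Max (p ` {1..m}))"

end

theory Submission
  imports Defs "Jordan_Normal_Form.Determinant"
begin

text \<open>Write \<open>r = p\<^sub>n\<^sub>+\<^sub>1\<close>, \<open>P = p\<^sub>1 \<cdots> p\<^sub>n\<close> and \<open>s = \<Sum>(p\<^sub>i - 1)\<close>, so that \<open>q = P - s\<close>. If \<open>r \<le> P\<close>, all tensors of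
  rank less than \<open>r\<close> are zeros of an \<open>r \<times> r\<close> minor of the flattening, hence form a null set; and no tensor
  has rank greater than \<open>P\<close>. A sum of \<open>r\<close> simple tensors depends on \<open>r (s + r)\<close> parameters once one coordinate
  of each of the first \<open>n\<close> vectors is scaled to 1, and this is less than the dimension \<open>P r\<close> if \<open>r < q\<close>; then the
  tensors of rank at most \<open>r\<close> form a null set.

  If \<open>q \<le> r\<close>, consider the map from parameters to \<open>\<Sum>\<^sub>k x\<^sub>k \<otimes> c\<^sub>k\<close> with simple \<open>x\<^sub>k\<close>, near a point where \<open>c\<^sub>k\<close> is the
  \<open>k\<close>-th unit vector. Its derivative is onto iff for every \<open>l\<close> the vectors \<open>x\<^sub>k\<close> together with the tangent space of
  the simple tensors at \<open>x\<^sub>l\<close> span everything. For one fixed \<open>l\<close> this is achieved with unit tensors, because the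
  tangent space has codimension \<open>q - 1 \<le> r - 1\<close>. As each condition is that some polynomial does not vanish, all of
  them hold at a common point, and the image contains a cube by an inverse function argument.\<close>

section \<open>Polynomial functions\<close>

text \<open>Polynomials are treated as functions on all of \<open>'v \<Rightarrow> real\<close> in
  which only coordinates from \<open>I\<close> occur. Analytic facts then follow by rule induction,
  and index sets of any type can serve as sets of variables.\<close>

inductive polyfun :: "'v set \<Rightarrow> (('v \<Rightarrow> real) \<Rightarrow> real) \<Rightarrow> bool" for I where
  polyfun_const: "polyfun I (\<lambda>_. c)"
| polyfun_coord: "i \<in> I \<Longrightarrow> polyfun I (\<lambda>x. x i)"
| polyfun_add: "polyfun I f \<Longrightarrow> polyfun I g \<Longrightarrow> polyfun I (\<lambda>x. f x + g x)"
| polyfun_mult: "polyfun I f \<Longrightarrow> polyfun I g \<Longrightarrow> polyfun I (\<lambda>x. f x * g x)"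

lemma polyfun_sum: "(\<And>a. a \<in> A \<Longrightarrow> polyfun I (f a)) \<Longrightarrow> polyfun I (\<lambda>x. \<Sum>a\<in>A. f a x)"
  by (induction A rule: infinite_finite_induct) (auto intro: polyfun.intros)

lemma polyfun_prod: "(\<And>a. a \<in> A \<Longrightarrow> polyfun I (f a)) \<Longrightarrow> polyfun I (\<lambda>x. \<Prod>a\<in>A. f a x)"
  by (induction A rule: infinite_finite_induct) (auto intro: polyfun.intros)

lemma polyfun_compose:
  assumes "polyfun I f" "\<And>i. i \<in> I \<Longrightarrow> polyfun J (g i)"
  shows "polyfun J (\<lambda>x. f (\<lambda>i. g i x))"
  using assms(1) by induction (auto intro: polyfun.intros assms(2))

lemma polyfun_cong:
  assumes "polyfun I f" "\<And>i. i \<in> I \<Longrightarrow> x i = y i"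
  shows "f x = f y"
  using assms(1) by induction (auto simp: assms(2))

text \<open>Along a line a polynomial function becomes a univariate polynomial, so questions of
  vanishing reduce to the finiteness of root sets.\<close>

lemma polyfun_line:
  assumes "polyfun I f"
  obtains P where "\<And>u. f (\<lambda>i. x i + u * y i) = poly P u"
proof -
  have "\<exists>P. \<forall>u. f (\<lambda>i. x i + u * y i) = poly P u"
    using assms
  proof induction
    case (polyfun_const c)
    show ?case by (rule exI[of _ "[:c:]"]) simp
  next
    case (polyfun_coord i)
    show ?case by (rule exI[of _ "[:x i, y i:]"]) simp
  next
    case (polyfun_add f g)
    then obtain P Q where "\<forall>u. f (\<lambda>i. x i + u * y i) = poly P u"
      "\<forall>u. g (\<lambda>i. x i + u * y i) = poly Q u" by blast
    then show ?case by (intro exI[of _ "P + Q"]) simp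
  next
    case (polyfun_mult f g)
    then obtain P Q where "\<forall>u. f (\<lambda>i. x i + u * y i) = poly P u"
      "\<forall>u. g (\<lambda>i. x i + u * y i) = poly Q u" by blast
    then show ?case by (intro exI[of _ "P * Q"]) simp
  qed
  then show thesis using that by blast
qed

text \<open>Induction on \<open>L\<close>: on the line from a point where one function is nonzero to
  a point where the product of the others is nonzero, both restrict to nonzero univariate
  polynomials. Their product is again nonzero, so it has a non-root.\<close>

lemma polyfun_common_nonzero:
  assumes "finite L" "\<And>l. l \<in> L \<Longrightarrow> polyfun I (f l)" "\<And>l. l \<in> L \<Longrightarrow> \<exists>x. f l x \<noteq> 0"
  shows "\<exists>x. \<forall>l\<in>L. f l x \<noteq> 0"
proof -
  have "\<exists>x. (\<Prod>l\<in>L. f l x) \<noteq> 0"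
    using assms
  proof (induction L)
    case (insert l L)
    then obtain x y where x: "f l x \<noteq> 0" and y: "(\<Prod>l\<in>L. f l y) \<noteq> 0"
      by (metis insertCI)
    obtain P where P: "\<And>u. f l (\<lambda>i. x i + u * (y i - x i)) = poly P u"
      using polyfun_line[OF insert.prems(1)[of l], of x "\<lambda>i. y i - x i"] by blast
    have "polyfun I (\<lambda>x. \<Prod>l\<in>L. f l x)"
      using insert.prems(1) by (intro polyfun_prod) auto
    then obtain Q where Q: "\<And>u. (\<Prod>l\<in>L. f l (\<lambda>i. x i + u * (y i - x i))) = poly Q u"
      using polyfun_line[of I _ x "\<lambda>i. y i - x i"] by blast
    from x y have "P \<noteq> 0" "Q \<noteq> 0" using P[of 0] Q[of 1] by auto
    then have "P * Q \<noteq> 0" by simp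
    then obtain u where "poly (P * Q) u \<noteq> 0" using poly_all_0_iff_0 by blast
    then show ?case using P Q insert.hyps by (intro exI[of _ "\<lambda>i. x i + u * (y i - x i)"]) simp
  qed simp
  then show ?thesis using assms(1) by auto
qed

section \<open>Continuity, null zero sets and Lipschitz bounds of polynomial functions\<close>

lemma polyfun_continuous: "polyfun I f \<Longrightarrow> continuous_on UNIV f"
  by (induction rule: polyfun.induct) (auto intro!: continuous_intros)

lemma polyfun_measurable:
  "polyfun I f \<Longrightarrow> f \<in> borel_measurable (Pi\<^sub>M I (\<lambda>_. lborel))"
  by (induction rule: polyfun.induct) auto

interpretation lborel_PiM: product_sigma_finite "\<lambda>_. lborel :: real measure"
  by standard

text \<open>Fubini in the newly inserted coordinate: for almost all values of the others, the slice
  is a nonzero univariate polynomial and has only finitely many zeros.\<close>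

lemma AE_polyfun_nonzero:
  assumes "finite I" "polyfun I f" "f z \<noteq> 0"
  shows "AE x in Pi\<^sub>M I (\<lambda>_. lborel). f x \<noteq> 0"
  using assms
proof (induction I arbitrary: f)
  case empty
  then have "f x \<noteq> 0" for x using polyfun_cong[of "{}" f x z] by auto
  then show ?case by simp
next
  case (insert i I)
  note meas = polyfun_measurable[OF insert.prems(1), measurable]
  \<comment> \<open>With coordinate \<open>i\<close> frozen at \<open>z i\<close>, the function is a
    polynomial in the coordinates from \<open>I\<close> that is still nonzero at \<open>z\<close>,
    so the induction hypothesis applies.\<close>
  have "polyfun I (\<lambda>x. f (\<lambda>j. (if j = i then (\<lambda>_. z i) else (\<lambda>x. x j)) x))"
    by (rule polyfun_compose[OF insert.prems(1)]) (auto intro: polyfun.intros)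
  also have "(\<lambda>x. f (\<lambda>j. (if j = i then (\<lambda>_. z i) else (\<lambda>x. x j)) x)) = (\<lambda>x. f (x(i := z i)))"
    by (intro ext arg_cong[of _ _ f]) auto
  finally have "AE x in Pi\<^sub>M I (\<lambda>_. lborel). f (x(i := z i)) \<noteq> 0"
    using insert.IH[of "\<lambda>x. f (x(i := z i))"] insert.prems(2) by simp
  then have AE: "AE x in Pi\<^sub>M I (\<lambda>_. lborel). (\<integral>\<^sup>+y. indicator {x. f x = 0} (x(i := y)) \<partial>lborel) = 0"
  proof (rule AE_mp, intro AE_I2 impI)
    fix x assume nz: "f (x(i := z i)) \<noteq> 0"
    \<comment> \<open>\<open>P\<close> describes the slice through \<open>x\<close> in direction
      \<open>i\<close>; its value at \<open>z i\<close> shows that it is not the zero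
      polynomial.\<close>
    obtain P where P: "\<And>u. f (\<lambda>j. (x(i := 0)) j + u * (if j = i then 1 else 0)) = poly P u"
      using polyfun_line[OF insert.prems(1), of "x(i := 0)" "\<lambda>j. if j = i then 1 else 0"] by blast
    have P': "f (x(i := u)) = poly P u" for u
      unfolding P[symmetric] by (intro arg_cong[of _ _ f]) auto
    with nz have "P \<noteq> 0" by auto
    then have fin: "finite {u. poly P u = 0}" using poly_roots_finite by blast
    have "(\<integral>\<^sup>+y. indicator {x. f x = 0} (x(i := y)) \<partial>lborel)
      = (\<integral>\<^sup>+y. indicator {u. poly P u = 0} y \<partial>lborel)"
      using P' by (intro nn_integral_cong) (auto split: split_indicator)
    also have "\<dots> = emeasure lborel {u. poly P u = 0}"
      using fin by (intro nn_integral_indicator) (auto intro: borel_closed finite_imp_closed)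
    also have "\<dots> = 0" using fin by (intro emeasure_lborel_countable countable_finite)
    finally show "(\<integral>\<^sup>+y. indicator {x. f x = 0} (x(i := y)) \<partial>lborel) = 0" .
  qed
  let ?M = "Pi\<^sub>M (insert i I) (\<lambda>_. lborel :: real measure)"
  have ind: "(\<lambda>x. indicator {x. f x = 0} x :: ennreal) \<in> borel_measurable ?M"
    by measurable
  have "emeasure ?M {x\<in>space ?M. f x = 0} = (\<integral>\<^sup>+x. indicator {x\<in>space ?M. f x = 0} x \<partial>?M)"
    by (rule nn_integral_indicator[symmetric]) measurable
  also have "\<dots> = (\<integral>\<^sup>+x. indicator {x. f x = 0} x \<partial>?M)"
    by (intro nn_integral_cong) (auto split: split_indicator)
  also have "\<dots> = (\<integral>\<^sup>+x. (\<integral>\<^sup>+y. indicator {x. f x = 0} (x(i := y)) \<partial>lborel) \<partial>Pi\<^sub>M I (\<lambda>_. lborel))"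
    by (rule lborel_PiM.product_nn_integral_insert[OF insert.hyps ind])
  also have "\<dots> = (\<integral>\<^sup>+x. 0 \<partial>Pi\<^sub>M I (\<lambda>_. lborel :: real measure))"
    by (rule nn_integral_cong_AE[OF AE])
  finally have "emeasure ?M {x\<in>space ?M. f x = 0} = 0" by simp
  moreover have "{x\<in>space ?M. f x = 0} \<in> sets ?M" by measurable
  ultimately show ?case
    by (intro AE_I'[of "{x\<in>space ?M. f x = 0}"]) (auto simp: null_sets_def)
qed

text \<open>The bound and the Lipschitz constant are found together, since the product case needs
  bounds on the factors. Letting \<open>d\<close> be any number that dominates the coordinate
  differences avoids a supremum over \<open>I\<close>.\<close>

lemma polyfun_lipschitz:
  assumes "polyfun I f" "0 \<le> K"
  obtains B L where "0 \<le> L" "\<And>x. (\<And>i. i \<in> I \<Longrightarrow> \<bar>x i\<bar> \<le> K) \<Longrightarrow> \<bar>f x\<bar> \<le> B"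
    "\<And>x y d. (\<And>i. i \<in> I \<Longrightarrow> \<bar>x i\<bar> \<le> K) \<Longrightarrow> (\<And>i. i \<in> I \<Longrightarrow> \<bar>y i\<bar> \<le> K) \<Longrightarrow>
      (\<And>i. i \<in> I \<Longrightarrow> \<bar>x i - y i\<bar> \<le> d) \<Longrightarrow> 0 \<le> d \<Longrightarrow> \<bar>f x - f y\<bar> \<le> L * d"
proof -
  define bd where "bd f B L \<longleftrightarrow> 0 \<le> L \<and> (\<forall>x. (\<forall>i\<in>I. \<bar>x i\<bar> \<le> K) \<longrightarrow> \<bar>f x\<bar> \<le> B) \<and>
    (\<forall>x y d. (\<forall>i\<in>I. \<bar>x i\<bar> \<le> K) \<longrightarrow> (\<forall>i\<in>I. \<bar>y i\<bar> \<le> K) \<longrightarrow> (\<forall>i\<in>I. \<bar>x i - y i\<bar> \<le> d) \<longrightarrow> 0 \<le> d \<longrightarrow>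
      \<bar>f x - f y\<bar> \<le> L * d)" for f :: "('a \<Rightarrow> real) \<Rightarrow> real" and B L
  have "\<exists>B L. bd f B L"
    using assms(1)
  proof induction
    case (polyfun_const c)
    have "bd (\<lambda>_. c) \<bar>c\<bar> 0" by (auto simp: bd_def)
    then show ?case by blast
  next
    case (polyfun_coord i)
    then have "bd (\<lambda>x. x i) K 1" by (auto simp: bd_def)
    then show ?case by blast
  next
    case (polyfun_add f g)
    then obtain B L C M where f: "bd f B L" and g: "bd g C M" by blast
    have "\<bar>(f x + g x) - (f y + g y)\<bar> \<le> (L + M) * d"
      if "\<bar>f x - f y\<bar> \<le> L * d" "\<bar>g x - g y\<bar> \<le> M * d" for x y d
      using that by (simp add: distrib_right)
    then have "bd (\<lambda>x. f x + g x) (B + C) (L + M)"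
      using f g unfolding bd_def by (auto intro!: order.trans[OF abs_triangle_ineq] add_mono)
    then show ?case by blast
  next
    case (polyfun_mult f g)
    then obtain B L C M where f: "bd f B L" and g: "bd g C M" by blast
    \<comment> \<open>The origin lies in the box because \<open>0 \<le> K\<close>; evaluating there
      shows that both bounds are nonnegative.\<close>
    have z: "\<forall>i\<in>I. \<bar>(\<lambda>_. 0::real) i\<bar> \<le> K" using assms(2) by simp
    have BC: "0 \<le> B" "0 \<le> C"
      using f g z unfolding bd_def by (meson abs_ge_zero order.trans)+
    have *: "\<bar>f x * g x - f y * g y\<bar> \<le> (L * C + B * M) * d"
      if "\<bar>f x - f y\<bar> \<le> L * d" "\<bar>g x - g y\<bar> \<le> M * d" "\<bar>g x\<bar> \<le> C" "\<bar>f y\<bar> \<le> B" "0 \<le> L" "0 \<le> M" "0 \<le> d"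
      for x y d
    proof -
      have "\<bar>f x * g x - f y * g y\<bar> = \<bar>(f x - f y) * g x + f y * (g x - g y)\<bar>"
        by (simp add: algebra_simps)
      also have "\<dots> \<le> \<bar>f x - f y\<bar> * \<bar>g x\<bar> + \<bar>f y\<bar> * \<bar>g x - g y\<bar>"
        by (rule order.trans[OF abs_triangle_ineq]) (simp add: abs_mult)
      also have "\<dots> \<le> (L * d) * C + B * (M * d)"
        using that BC by (intro add_mono mult_mono) auto
      finally show ?thesis by (simp add: algebra_simps)
    qed
    have "bd (\<lambda>x. f x * g x) (B * C) (L * C + B * M)"
      using f g BC unfolding bd_def by (auto simp: abs_mult intro!: mult_mono *)
    then show ?case by blast
  qed
  then obtain B L where "bd f B L" by blast
  then show thesis using that[of L B] unfolding bd_def by blast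
qed

section \<open>Local surjectivity\<close>

text \<open>Strict differentiability at 0 with derivative 0; the number \<open>d\<close> stands for the sup norm of
  \<open>x - y\<close> over \<open>I\<close>.\<close>

definition strictly_flat :: "'v set \<Rightarrow> (('v \<Rightarrow> real) \<Rightarrow> real) \<Rightarrow> bool" where
  "strictly_flat I f \<longleftrightarrow> (\<forall>e>0. \<exists>\<delta>>0. \<forall>x y d. (\<forall>i\<in>I. \<bar>x i\<bar> \<le> \<delta>) \<longrightarrow> (\<forall>i\<in>I. \<bar>y i\<bar> \<le> \<delta>) \<longrightarrow>
     (\<forall>i\<in>I. \<bar>x i - y i\<bar> \<le> d) \<longrightarrow> 0 \<le> d \<longrightarrow> \<bar>f x - f y\<bar> \<le> e * d)"

definition linf :: "'v set \<Rightarrow> ('v \<Rightarrow> real) \<Rightarrow> ('v \<Rightarrow> real) \<Rightarrow> real" where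
  "linf I l x = (\<Sum>i\<in>I. l i * x i)"

lemma strictly_flatE:
  assumes "strictly_flat I f" "0 < e"
  obtains \<delta> where "0 < \<delta>" "\<And>x y d. (\<forall>i\<in>I. \<bar>x i\<bar> \<le> \<delta>) \<Longrightarrow> (\<forall>i\<in>I. \<bar>y i\<bar> \<le> \<delta>) \<Longrightarrow>
     (\<forall>i\<in>I. \<bar>x i - y i\<bar> \<le> d) \<Longrightarrow> 0 \<le> d \<Longrightarrow> \<bar>f x - f y\<bar> \<le> e * d"
  using assms unfolding strictly_flat_def by blast

lemma strictly_flat_const: "strictly_flat I (\<lambda>_. c)"
  unfolding strictly_flat_def by (auto intro: exI[of _ 1])

lemma strictly_flat_add:
  assumes "strictly_flat I f" "strictly_flat I g"
  shows "strictly_flat I (\<lambda>x. f x + g x)"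
  unfolding strictly_flat_def
proof (intro allI impI)
  fix e :: real assume "e > 0"
  then have "e / 2 > 0" by simp
  obtain a where a: "a > 0" "\<And>x y d. (\<forall>i\<in>I. \<bar>x i\<bar> \<le> a) \<Longrightarrow> (\<forall>i\<in>I. \<bar>y i\<bar> \<le> a) \<Longrightarrow>
     (\<forall>i\<in>I. \<bar>x i - y i\<bar> \<le> d) \<Longrightarrow> 0 \<le> d \<Longrightarrow> \<bar>f x - f y\<bar> \<le> e / 2 * d"
    by (rule strictly_flatE[OF assms(1) \<open>e / 2 > 0\<close>]) blast
  obtain b where b: "b > 0" "\<And>x y d. (\<forall>i\<in>I. \<bar>x i\<bar> \<le> b) \<Longrightarrow> (\<forall>i\<in>I. \<bar>y i\<bar> \<le> b) \<Longrightarrow>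
     (\<forall>i\<in>I. \<bar>x i - y i\<bar> \<le> d) \<Longrightarrow> 0 \<le> d \<Longrightarrow> \<bar>g x - g y\<bar> \<le> e / 2 * d"
    by (rule strictly_flatE[OF assms(2) \<open>e / 2 > 0\<close>]) blast
  have "\<bar>(f x + g x) - (f y + g y)\<bar> \<le> e * d"
    if "\<forall>i\<in>I. \<bar>x i\<bar> \<le> min a b" "\<forall>i\<in>I. \<bar>y i\<bar> \<le> min a b" "\<forall>i\<in>I. \<bar>x i - y i\<bar> \<le> d" "0 \<le> d" for x y d
  proof -
    have "\<bar>f x - f y\<bar> \<le> e / 2 * d" "\<bar>g x - g y\<bar> \<le> e / 2 * d"
      using a(2)[of x y d] b(2)[of x y d] that by auto
    moreover have "e / 2 * d + e / 2 * d = e * d" by simp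
    ultimately show ?thesis by linarith
  qed
  then show "\<exists>\<delta>>0. \<forall>x y d. (\<forall>i\<in>I. \<bar>x i\<bar> \<le> \<delta>) \<longrightarrow> (\<forall>i\<in>I. \<bar>y i\<bar> \<le> \<delta>) \<longrightarrow>
     (\<forall>i\<in>I. \<bar>x i - y i\<bar> \<le> d) \<longrightarrow> 0 \<le> d \<longrightarrow> \<bar>(f x + g x) - (f y + g y)\<bar> \<le> e * d"
    using a(1) b(1) by (intro exI[of _ "min a b"]) auto
qed

text \<open>Both factors are Lipschitz and vanish at 0, so on the box of radius \<open>c\<close>
  they are of size O(\<open>c\<close>), and the Lipschitz constant of their product there is at most
  \<open>2 * L * M * c\<close>. This is the nonlinear term of the product rule.\<close>

lemma strictly_flat_mult_vanishing:
  assumes f: "polyfun I f" "f (\<lambda>_. 0) = 0" and g: "polyfun I g" "g (\<lambda>_. 0) = 0"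
  shows "strictly_flat I (\<lambda>x. f x * g x)"
proof -
  obtain L where L: "0 \<le> L" "\<And>x y d. (\<And>i. i \<in> I \<Longrightarrow> \<bar>x i\<bar> \<le> 1) \<Longrightarrow> (\<And>i. i \<in> I \<Longrightarrow> \<bar>y i\<bar> \<le> 1) \<Longrightarrow>
      (\<And>i. i \<in> I \<Longrightarrow> \<bar>x i - y i\<bar> \<le> d) \<Longrightarrow> 0 \<le> d \<Longrightarrow> \<bar>f x - f y\<bar> \<le> L * d"
    by (rule polyfun_lipschitz[OF f(1) zero_le_one]) blast
  obtain M where M: "0 \<le> M" "\<And>x y d. (\<And>i. i \<in> I \<Longrightarrow> \<bar>x i\<bar> \<le> 1) \<Longrightarrow> (\<And>i. i \<in> I \<Longrightarrow> \<bar>y i\<bar> \<le> 1) \<Longrightarrow>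
      (\<And>i. i \<in> I \<Longrightarrow> \<bar>x i - y i\<bar> \<le> d) \<Longrightarrow> 0 \<le> d \<Longrightarrow> \<bar>g x - g y\<bar> \<le> M * d"
    by (rule polyfun_lipschitz[OF g(1) zero_le_one]) blast
  show ?thesis
    unfolding strictly_flat_def
  proof (intro allI impI)
    fix e :: real assume e: "e > 0"
    \<comment> \<open>The minimum with 1 keeps the box inside the unit box, where \<open>L\<close>
      and \<open>M\<close> are valid; the summand 1 in the denominator covers
      \<open>L * M = 0\<close>.\<close>
    define c where "c = min 1 (e / (2 * L * M + 1))"
    have pos: "2 * L * M + 1 > 0" using L(1) M(1) by (simp add: add_nonneg_pos)
    have c: "0 < c" "c \<le> 1" using e pos by (auto simp: c_def)
    have "c \<le> e / (2 * L * M + 1)" by (simp add: c_def)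
    then have "c * (2 * L * M + 1) \<le> e" using pos by (simp add: pos_le_divide_eq)
    then have ce: "2 * L * M * c \<le> e" using c by (simp add: algebra_simps)
    have "\<bar>f x * g x - f y * g y\<bar> \<le> e * d"
      if x: "\<forall>i\<in>I. \<bar>x i\<bar> \<le> c" and y: "\<forall>i\<in>I. \<bar>y i\<bar> \<le> c" and xy: "\<forall>i\<in>I. \<bar>x i - y i\<bar> \<le> d" and d: "0 \<le> d" for x y d
    proof -
      have x1: "\<bar>x i\<bar> \<le> 1" and y1: "\<bar>y i\<bar> \<le> 1" if "i \<in> I" for i
        using x y that c by force+
      have 1: "\<bar>f x - f y\<bar> \<le> L * d" "\<bar>g x - g y\<bar> \<le> M * d"
        using L(2)[of x y d] M(2)[of x y d] x1 y1 xy d by auto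
      have 2: "\<bar>f y\<bar> \<le> L * c" "\<bar>g x\<bar> \<le> M * c"
        using L(2)[of y "\<lambda>_. 0" c] M(2)[of x "\<lambda>_. 0" c] x1 y1 x y c f(2) g(2) by auto
      have "\<bar>f x * g x - f y * g y\<bar> = \<bar>(f x - f y) * g x + f y * (g x - g y)\<bar>"
        by (simp add: algebra_simps)
      also have "\<dots> \<le> \<bar>f x - f y\<bar> * \<bar>g x\<bar> + \<bar>f y\<bar> * \<bar>g x - g y\<bar>"
        by (rule order.trans[OF abs_triangle_ineq]) (simp add: abs_mult)
      also have "\<dots> \<le> (L * d) * (M * c) + (L * c) * (M * d)"
        using 1 2 L(1) M(1) c d by (intro add_mono mult_mono) auto
      also have "\<dots> = (2 * L * M * c) * d" by (simp add: algebra_simps)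
      also have "\<dots> \<le> e * d" using ce d by (rule mult_right_mono)
      finally show ?thesis .
    qed
    then show "\<exists>\<delta>>0. \<forall>x y d. (\<forall>i\<in>I. \<bar>x i\<bar> \<le> \<delta>) \<longrightarrow> (\<forall>i\<in>I. \<bar>y i\<bar> \<le> \<delta>) \<longrightarrow>
     (\<forall>i\<in>I. \<bar>x i - y i\<bar> \<le> d) \<longrightarrow> 0 \<le> d \<longrightarrow> \<bar>f x * g x - f y * g y\<bar> \<le> e * d"
      using c(1) by blast
  qed
qed

lemma strictly_flat_cmult:
  assumes "strictly_flat I f"
  shows "strictly_flat I (\<lambda>x. c * f x)"
  unfolding strictly_flat_def
proof (intro allI impI)
  fix e :: real assume e: "e > 0"
  then have "e / (\<bar>c\<bar> + 1) > 0" by (simp add: add_nonneg_pos)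
  then obtain \<delta> where \<delta>: "\<delta> > 0" "\<And>x y d. (\<forall>i\<in>I. \<bar>x i\<bar> \<le> \<delta>) \<Longrightarrow> (\<forall>i\<in>I. \<bar>y i\<bar> \<le> \<delta>) \<Longrightarrow>
     (\<forall>i\<in>I. \<bar>x i - y i\<bar> \<le> d) \<Longrightarrow> 0 \<le> d \<Longrightarrow> \<bar>f x - f y\<bar> \<le> e / (\<bar>c\<bar> + 1) * d"
    using strictly_flatE[OF assms] by blast
  have "\<bar>c * f x - c * f y\<bar> \<le> e * d" if "\<bar>f x - f y\<bar> \<le> e / (\<bar>c\<bar> + 1) * d" "0 \<le> d" for x y d
  proof -
    have "\<bar>c * f x - c * f y\<bar> = \<bar>c\<bar> * \<bar>f x - f y\<bar>" by (simp add: right_diff_distrib flip: abs_mult)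
    also have "\<dots> \<le> (\<bar>c\<bar> + 1) * (e / (\<bar>c\<bar> + 1) * d)"
      using that by (intro mult_mono) auto
    also have "\<dots> = e * d" by (simp add: add_nonneg_pos)
    finally show ?thesis .
  qed
  then show "\<exists>\<delta>>0. \<forall>x y d. (\<forall>i\<in>I. \<bar>x i\<bar> \<le> \<delta>) \<longrightarrow> (\<forall>i\<in>I. \<bar>y i\<bar> \<le> \<delta>) \<longrightarrow>
     (\<forall>i\<in>I. \<bar>x i - y i\<bar> \<le> d) \<longrightarrow> 0 \<le> d \<longrightarrow> \<bar>c * f x - c * f y\<bar> \<le> e * d"
    using \<delta> by blast
qed

lemma polyfun_minus_const: "polyfun I f \<Longrightarrow> polyfun I (\<lambda>x. f x - c)"
  using polyfun_add[OF _ polyfun_const, of I f "- c"] by simp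

text \<open>Polynomial functions are strictly differentiable at 0. Coordinates are linear, and
  products reduce to \<open>strictly_flat_mult_vanishing\<close> after subtracting the values at
  0.\<close>

lemma polyfun_strictly_flat_remainder:
  assumes "finite I" "polyfun I f"
  obtains l where "strictly_flat I (\<lambda>x. f x - linf I l x)"
proof -
  have "\<exists>l. strictly_flat I (\<lambda>x. f x - linf I l x)"
    using assms(2)
  proof induction
    case (polyfun_const c)
    show ?case by (rule exI[of _ "\<lambda>_. 0"]) (simp add: linf_def strictly_flat_const)
  next
    case (polyfun_coord i)
    then have "linf I (\<lambda>j. if j = i then 1 else 0) x = x i" for x
      using assms(1) by (simp add: linf_def if_distrib[of "\<lambda>c. c * _"] cong: if_cong)
    then show ?case
      by (intro exI[of _ "\<lambda>j. if j = i then 1 else 0"]) (simp add: strictly_flat_const)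
  next
    case (polyfun_add f g)
    then obtain l m where *: "strictly_flat I (\<lambda>x. f x - linf I l x)" "strictly_flat I (\<lambda>x. g x - linf I m x)" by blast
    have "f x + g x - linf I (\<lambda>i. l i + m i) x = (f x - linf I l x) + (g x - linf I m x)" for x
      by (simp add: linf_def distrib_right sum.distrib)
    then show ?case using strictly_flat_add[OF *] by (intro exI[of _ "\<lambda>i. l i + m i"]) presburger
  next
    case (polyfun_mult f g)
    then obtain l m where *: "strictly_flat I (\<lambda>x. f x - linf I l x)" "strictly_flat I (\<lambda>x. g x - linf I m x)" by blast
    define f0 where "f0 = f (\<lambda>_. 0)"
    define g0 where "g0 = g (\<lambda>_. 0)"
    have "strictly_flat I (\<lambda>x. (f x - f0) * (g x - g0))"
      by (intro strictly_flat_mult_vanishing polyfun_minus_const polyfun_mult) (auto simp: f0_def g0_def)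
    \<comment> \<open>With \<open>l\<close> and \<open>m\<close> standing for their linear forms,
      the identity is \<open>f g - (f0 m + g0 l) = (f - f0) (g - g0) + f0 (g - m) + g0 (f - l) - f0
      g0\<close>.\<close>
    from strictly_flat_add[OF strictly_flat_add[OF strictly_flat_add[OF this strictly_flat_cmult[OF *(2), of f0]] strictly_flat_cmult[OF *(1), of g0]] strictly_flat_const[of I "- f0 * g0"]]
    have "strictly_flat I (\<lambda>x. f x * g x - (f0 * linf I m x + g0 * linf I l x))"
      by (simp add: algebra_simps)
    moreover have "linf I (\<lambda>i. f0 * m i + g0 * l i) x = f0 * linf I m x + g0 * linf I l x" for x
      by (simp add: linf_def sum_distrib_left algebra_simps sum.distrib)
    ultimately show ?case by (intro exI[of _ "\<lambda>i. f0 * m i + g0 * l i"]) simp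
  qed
  then show thesis using that by blast
qed

text \<open>This determines the linear part by derivatives along lines through 0, which ordinary
  differentiation computes.\<close>

lemma strictly_flat_remainder_derivative:
  assumes I: "finite I" and f: "strictly_flat I (\<lambda>x. f x - linf I l x)"
  shows "((\<lambda>t. f (\<lambda>i. t * y i)) has_real_derivative linf I l y) (at 0)"
proof -
  \<comment> \<open>\<open>Y\<close> dominates all coordinates of \<open>y\<close>, so
    \<open>\<bar>h\<bar> * Y\<close> dominates those of \<open>h * y\<close>; the summand 1 makes it
    positive.\<close>
  define Y where "Y = 1 + (\<Sum>i\<in>I. \<bar>y i\<bar>)"
  have Y: "Y > 0" by (simp add: Y_def add_pos_nonneg sum_nonneg)
  have yY: "\<bar>y i\<bar> \<le> Y" if "i \<in> I" for i
    using member_le_sum[OF that, of "\<lambda>i. \<bar>y i\<bar>"] I by (simp add: Y_def)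
  have lin: "linf I l (\<lambda>i. t * y i) = t * linf I l y" for t
    by (simp add: linf_def sum_distrib_left algebra_simps)
  show ?thesis
    unfolding DERIV_def
  proof (rule LIM_I)
    fix r :: real assume r: "0 < r"
    then have "r / (2 * Y) > 0" using Y by simp
    then obtain \<delta> where \<delta>: "\<delta> > 0" "\<And>x y d. (\<forall>i\<in>I. \<bar>x i\<bar> \<le> \<delta>) \<Longrightarrow> (\<forall>i\<in>I. \<bar>y i\<bar> \<le> \<delta>) \<Longrightarrow>
     (\<forall>i\<in>I. \<bar>x i - y i\<bar> \<le> d) \<Longrightarrow> 0 \<le> d \<Longrightarrow> \<bar>(f x - linf I l x) - (f y - linf I l y)\<bar> \<le> r / (2 * Y) * d"
      using strictly_flatE[OF f] by blast
    have "norm ((f (\<lambda>i. (0 + h) * y i) - f (\<lambda>i. 0 * y i)) / h - linf I l y) < r"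
      if h: "h \<noteq> 0" "norm (h - 0) < \<delta> / Y" for h
    proof -
      have hy: "\<bar>h * y i\<bar> \<le> \<bar>h\<bar> * Y" if "i \<in> I" for i
        using yY[OF that] by (simp add: abs_mult mult_left_mono)
      have "\<bar>h\<bar> * Y \<le> \<delta>" using h(2) Y by (simp add: field_simps)
      then have "\<bar>(f (\<lambda>i. h * y i) - linf I l (\<lambda>i. h * y i)) - (f (\<lambda>i. 0 * y i) - linf I l (\<lambda>i. 0 * y i))\<bar>
        \<le> r / (2 * Y) * (\<bar>h\<bar> * Y)"
        using hy \<delta>(1) Y by (intro \<delta>(2)) force+
      also have "\<dots> = r / 2 * \<bar>h\<bar>" using Y by simp
      finally have "\<bar>f (\<lambda>i. h * y i) - f (\<lambda>i. 0 * y i) - h * linf I l y\<bar> \<le> r / 2 * \<bar>h\<bar>"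
        unfolding lin by (simp add: algebra_simps)
      moreover have "(f (\<lambda>i. h * y i) - f (\<lambda>i. 0 * y i)) / h - linf I l y
         = (f (\<lambda>i. h * y i) - f (\<lambda>i. 0 * y i) - h * linf I l y) / h"
        using h(1) by (simp add: field_simps)
      ultimately have "\<bar>(f (\<lambda>i. h * y i) - f (\<lambda>i. 0 * y i)) / h - linf I l y\<bar> \<le> r / 2"
        using h(1) by (simp add: abs_divide divide_le_eq)
      then show ?thesis using r by simp
    qed
    then show "\<exists>s>0. \<forall>x. x \<noteq> 0 \<and> norm (x - 0) < s \<longrightarrow>
       norm ((f (\<lambda>i. (0 + x) * y i) - f (\<lambda>i. 0 * y i)) / x - linf I l y) < r"
      using \<delta>(1) Y by (intro exI[of _ "\<delta> / Y"]) auto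
  qed
qed

text \<open>Contraction argument: the map sending \<open>x\<close> to \<open>x - G x + T\<close>
  halves sup distances on the box of radius \<delta> and maps this box into itself, since
  \<open>T\<close> is within \<open>\<delta> / 2\<close> of the value of \<open>G\<close> at 0. The
  limit of its iterates from 0 is a solution.\<close>

lemma perturbed_identity_solvable:
  fixes G :: "'v \<Rightarrow> ('v \<Rightarrow> real) \<Rightarrow> real"
  assumes "0 < \<delta>"
    and G: "\<And>x y d j. \<forall>i\<in>I. \<bar>x i\<bar> \<le> \<delta> \<Longrightarrow> \<forall>i\<in>I. \<bar>y i\<bar> \<le> \<delta> \<Longrightarrow> \<forall>i\<in>I. \<bar>x i - y i\<bar> \<le> d \<Longrightarrow>
       0 \<le> d \<Longrightarrow> j \<in> I \<Longrightarrow> \<bar>(G j x - x j) - (G j y - y j)\<bar> \<le> d / 2"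
    and T: "\<And>j. j \<in> I \<Longrightarrow> \<bar>T j - G j (\<lambda>_. 0)\<bar> \<le> \<delta> / 2"
    and cont: "\<And>j. j \<in> I \<Longrightarrow> continuous_on UNIV (G j)"
  obtains x where "\<And>j. j \<in> I \<Longrightarrow> G j x = T j"
proof -
  \<comment> \<open>The iterates are set to 0 outside \<open>I\<close>, so that the sequence
    converges in every coordinate.\<close>
  define u where "u = rec_nat (\<lambda>_. 0) (\<lambda>k x j. if j \<in> I then x j - G j x + T j else 0)"
  have u0: "u 0 = (\<lambda>_. 0)" by (simp add: u_def)
  have uS: "u (Suc k) j = (if j \<in> I then u k j - G j (u k) + T j else 0)" for k j
    by (simp add: u_def)
  have box: "\<forall>j\<in>I. \<bar>u k j\<bar> \<le> \<delta>" for k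
  proof (induction k)
    case 0
    then show ?case using assms(1) by (simp add: u0)
  next
    case (Suc k)
    show ?case
    proof
      fix j assume j: "j \<in> I"
      have "\<bar>(G j (u k) - u k j) - (G j (\<lambda>_. 0) - 0)\<bar> \<le> \<delta> / 2"
        using G[of "u k" "\<lambda>_. 0" \<delta> j] Suc assms(1) j by simp
      then show "\<bar>u (Suc k) j\<bar> \<le> \<delta>" using T[OF j] j by (simp add: uS abs_if split: if_splits)
    qed
  qed
  have step: "\<forall>j\<in>I. \<bar>u (Suc k) j - u k j\<bar> \<le> \<delta> * (1/2)^k" for k
  proof (induction k)
    case 0
    have "\<bar>T j - G j (\<lambda>_. 0)\<bar> \<le> \<delta>" if "j \<in> I" for j
      using T[OF that] assms(1) by linarith
    then show ?case by (simp add: uS u0)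
  next
    case (Suc k)
    show ?case
    proof
      fix j assume j: "j \<in> I"
      have "\<bar>(G j (u (Suc k)) - u (Suc k) j) - (G j (u k) - u k j)\<bar> \<le> \<delta> * (1/2)^k / 2"
        using G[of "u (Suc k)" "u k" "\<delta> * (1/2)^k" j] box Suc assms(1) j by simp
      then have *: "\<bar>(u (Suc k) j - G j (u (Suc k)) + T j) - (u k j - G j (u k) + T j)\<bar> \<le> \<delta> * (1/2)^Suc k"
        by (simp add: abs_if split: if_splits)
      show "\<bar>u (Suc (Suc k)) j - u (Suc k) j\<bar> \<le> \<delta> * (1/2)^Suc k"
        using * j by (simp only: uS[of "Suc k"] uS[of k j] if_True)
    qed
  qed
  have conv: "convergent (\<lambda>k. u k j)" for j
  proof (cases "j \<in> I")
    case True
    have "summable (\<lambda>k. u (Suc k) j - u k j)"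
    proof (rule summable_comparison_test')
      show "summable (\<lambda>k. \<delta> * (1/2)^k)" by (intro summable_mult summable_geometric) simp
      show "norm (u (Suc k) j - u k j) \<le> \<delta> * (1/2)^k" if "k \<ge> 0" for k
        using step True by auto
    qed
    then have "convergent (\<lambda>n. \<Sum>k<n. u (Suc k) j - u k j)"
      by (simp add: summable_iff_convergent)
    also have "(\<lambda>n. \<Sum>k<n. u (Suc k) j - u k j) = (\<lambda>n. u n j)"
      by (simp add: sum_lessThan_telescope[of "\<lambda>k. u k j"] u0 del: sum_subtractf)
    finally show ?thesis .
  next
    case False
    then have "u k j = 0" for k by (cases k) (simp_all add: u0 uS)
    then show ?thesis by (simp add: convergent_const)
  qed
  define x where "x = (\<lambda>j. lim (\<lambda>k. u k j))"
  have lim: "(\<lambda>k. u k j) \<longlonglongrightarrow> x j" for j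
    using conv by (simp add: x_def convergent_LIMSEQ_iff)
  \<comment> \<open>Continuity of \<open>G j\<close> refers to the product topology, where
    convergence is coordinatewise.\<close>
  have lim': "u \<longlonglongrightarrow> x"
    using lim limitin_componentwise[of "\<lambda>_. euclidean" UNIV u x sequentially]
    by (simp add: euclidean_product_topology)
  have "G j x = T j" if j: "j \<in> I" for j
  proof -
    have "(\<lambda>k. G j (u k)) \<longlonglongrightarrow> G j x"
      using continuous_on_tendsto_compose[OF cont[OF j] lim'] by simp
    then have "(\<lambda>k. u k j - G j (u k) + T j) \<longlonglongrightarrow> x j - G j x + T j"
      by (intro tendsto_intros lim)
    moreover have "(\<lambda>k. u k j - G j (u k) + T j) = (\<lambda>k. u (Suc k) j)"
      using j by (simp add: uS)
    ultimately have "x j - G j x + T j = x j"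
      using LIMSEQ_unique LIMSEQ_Suc[OF lim[of j]] by metis
    then show ?thesis by simp
  qed
  then show thesis using that by blast
qed

text \<open>The derivatives along lines force the linear part of \<open>G j\<close> to be the
  coordinate \<open>j\<close>. Strict differentiability then makes the difference of
  \<open>G\<close> and the identity a contraction with factor 1/2 near 0.\<close>

lemma polyfun_local_inverse:
  assumes I: "finite I" and G: "\<And>j. j \<in> I \<Longrightarrow> polyfun I (G j)"
    and D: "\<And>j y. j \<in> I \<Longrightarrow> ((\<lambda>t. G j (\<lambda>i. t * y i)) has_real_derivative y j) (at 0)"
  obtains \<delta> where "0 < \<delta>"
    "\<And>T. (\<And>j. j \<in> I \<Longrightarrow> \<bar>T j - G j (\<lambda>_. 0)\<bar> \<le> \<delta>) \<Longrightarrow> \<exists>x. \<forall>j\<in>I. G j x = T j"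
proof -
  have strictly_flat: "strictly_flat I (\<lambda>x. G j x - x j)" if j: "j \<in> I" for j
  proof -
    obtain l where l: "strictly_flat I (\<lambda>x. G j x - linf I l x)"
      using polyfun_strictly_flat_remainder[OF I G[OF j]] by blast
    have "linf I l x = x j" for x
      using DERIV_unique[OF strictly_flat_remainder_derivative[OF I l] D[OF j]] .
    then show ?thesis using l by simp
  qed
  have "\<forall>j\<in>I. \<exists>\<delta>>0. \<forall>x y d. (\<forall>i\<in>I. \<bar>x i\<bar> \<le> \<delta>) \<longrightarrow> (\<forall>i\<in>I. \<bar>y i\<bar> \<le> \<delta>) \<longrightarrow>
     (\<forall>i\<in>I. \<bar>x i - y i\<bar> \<le> d) \<longrightarrow> 0 \<le> d \<longrightarrow> \<bar>(G j x - x j) - (G j y - y j)\<bar> \<le> 1/2 * d"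
  proof
    fix j assume "j \<in> I"
    with strictly_flat have "strictly_flat I (\<lambda>x. G j x - x j)" .
    then show "\<exists>\<delta>>0. \<forall>x y d. (\<forall>i\<in>I. \<bar>x i\<bar> \<le> \<delta>) \<longrightarrow> (\<forall>i\<in>I. \<bar>y i\<bar> \<le> \<delta>) \<longrightarrow>
       (\<forall>i\<in>I. \<bar>x i - y i\<bar> \<le> d) \<longrightarrow> 0 \<le> d \<longrightarrow> \<bar>(G j x - x j) - (G j y - y j)\<bar> \<le> 1/2 * d"
      unfolding strictly_flat_def by (rule allE[of _ "1/2"]) simp
  qed
  from bchoice[OF this]
  obtain \<Delta> where \<Delta>: "\<And>j. j \<in> I \<Longrightarrow> \<Delta> j > (0::real)"
    "\<And>j x y d. j \<in> I \<Longrightarrow> (\<forall>i\<in>I. \<bar>x i\<bar> \<le> \<Delta> j) \<Longrightarrow> (\<forall>i\<in>I. \<bar>y i\<bar> \<le> \<Delta> j) \<Longrightarrow>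
     (\<forall>i\<in>I. \<bar>x i - y i\<bar> \<le> d) \<Longrightarrow> 0 \<le> d \<Longrightarrow> \<bar>(G j x - x j) - (G j y - y j)\<bar> \<le> 1/2 * d"
    by blast
  \<comment> \<open>The inserted 1 keeps the minimum meaningful for empty \<open>I\<close>.\<close>
  define \<delta> where "\<delta> = Min (insert 1 (\<Delta> ` I))"
  have \<delta>: "0 < \<delta>" and \<delta>le: "\<And>j. j \<in> I \<Longrightarrow> \<delta> \<le> \<Delta> j"
    using I \<Delta>(1) by (auto simp: \<delta>_def)
  have "\<exists>x. \<forall>j\<in>I. G j x = T j" if T: "\<And>j. j \<in> I \<Longrightarrow> \<bar>T j - G j (\<lambda>_. 0)\<bar> \<le> \<delta> / 2" for T
  proof (rule perturbed_identity_solvable[OF \<delta>, of I G T])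
    fix x y :: "'a \<Rightarrow> real" and d j
    assume "\<forall>i\<in>I. \<bar>x i\<bar> \<le> \<delta>" "\<forall>i\<in>I. \<bar>y i\<bar> \<le> \<delta>" "\<forall>i\<in>I. \<bar>x i - y i\<bar> \<le> d" "0 \<le> d" "j \<in> I"
    then show "\<bar>(G j x - x j) - (G j y - y j)\<bar> \<le> d / 2"
      using \<Delta>(2)[of j x y d] \<delta>le by force
  qed (use T G polyfun_continuous in auto)
  then show thesis using that[of "\<delta> / 2"] \<delta> by simp
qed

section \<open>Images of polynomial maps\<close>

text \<open>The elements are extensional arrays, as in \<open>tensor_space\<close>. With sums of
  \<open>r\<close> simple tensors for \<open>g\<close> this becomes the set of tensors of rank at
  most \<open>r\<close>.\<close>

definition poly_image :: "'i set \<Rightarrow> ('i \<Rightarrow> ('v \<Rightarrow> real) \<Rightarrow> real) \<Rightarrow> ('i \<Rightarrow> real) set" where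
  "poly_image I g = {T \<in> (\<Pi>\<^sub>E i\<in>I. UNIV). \<exists>x. \<forall>i\<in>I. T i = g i x}"

text \<open>Coordinates are moved to \<open>nat \<Rightarrow> real\<close>, where Borel sets of the product topology and product-measurable
  sets agree; there the image is a countable union of compact sets.\<close>

lemma measurable_poly_image:
  fixes g :: "'i \<Rightarrow> ('v \<Rightarrow> real) \<Rightarrow> real"
  assumes I: "finite I" and g: "\<And>i. i \<in> I \<Longrightarrow> polyfun S (g i)" and S: "finite S"
  shows "poly_image I g \<in> sets (Pi\<^sub>M I (\<lambda>_. lborel))"
proof -
  obtain h :: "nat \<Rightarrow> 'i" and N where h: "bij_betw h {..<N} I"
    using ex_bij_betw_nat_finite[OF I] by (auto simp: lessThan_atLeast0)
  define conv where "conv T = (\<lambda>k. if k < N then T (h k) else 0)" for T :: "'i \<Rightarrow> real"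
  define \<Psi> where "\<Psi> x = (\<lambda>k. if k < N then g (h k) x else 0)" for x
  \<comment> \<open>The cube has a factor for every element of \<open>'v\<close>; by Tychonoff it is
    compact even if \<open>'v\<close> is infinite.\<close>
  define C where "C K = (\<Pi>\<^sub>E v\<in>(UNIV :: 'v set). {-real K..real K})" for K
  have hI: "h k \<in> I" if "k < N" for k using h that by (auto simp: bij_betw_def)
  have "continuous_on UNIV \<Psi>"
    unfolding \<Psi>_def
  proof (rule continuous_on_coordinatewise_then_product)
    show "continuous_on UNIV (\<lambda>x. if k < N then g (h k) x else 0)" for k
      using polyfun_continuous[OF g[OF hI]] by (cases "k < N") auto
  qed
  moreover have "compact (C K)" for K
    unfolding C_def using compactin_PiE[of "\<lambda>_. euclidean" "UNIV" "\<lambda>_. {-real K..real K}"]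
    by (simp add: euclidean_product_topology)
  ultimately have "compact (\<Psi> ` C K)" for K
    by (meson compact_continuous_image continuous_on_subset subset_UNIV)
  then have meas: "(\<Union>K. \<Psi> ` C K) \<in> sets borel"
    by (intro sets.countable_UN) (auto intro: borel_closed compact_imp_closed)
  have conv: "conv \<in> measurable (Pi\<^sub>M I (\<lambda>_. lborel)) borel"
    unfolding conv_def
  proof (rule measurable_coordinatewise_then_product)
    fix k
    show "(\<lambda>T :: 'i \<Rightarrow> real. if k < N then T (h k) else 0) \<in> borel_measurable (Pi\<^sub>M I (\<lambda>_. lborel))"
    proof (cases "k < N")
      case True
      then have "polyfun I (\<lambda>T. T (h k))" by (intro polyfun_coord hI)
      with True show ?thesis using polyfun_measurable by simp
    qed simp
  qed
  have "poly_image I g = conv -` (\<Union>K. \<Psi> ` C K) \<inter> space (Pi\<^sub>M I (\<lambda>_. lborel))"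
  proof (rule Set.set_eqI, rule iffI)
    fix T assume "T \<in> poly_image I g"
    then obtain x where T: "T \<in> (\<Pi>\<^sub>E i\<in>I. UNIV)" and x: "\<And>i. i \<in> I \<Longrightarrow> T i = g i x"
      by (auto simp: poly_image_def)
    \<comment> \<open>Setting the parameters outside \<open>S\<close> to 0 changes no value of
      \<open>g\<close> and puts the point into one of the cubes.\<close>
    define y where "y v = (if v \<in> S then x v else 0)" for v
    obtain K :: nat where K: "(\<Sum>v\<in>S. \<bar>x v\<bar>) \<le> real K"
      using real_arch_simple by blast
    have "\<bar>y v\<bar> \<le> K" for v
      using K member_le_sum[of v S "\<lambda>v. \<bar>x v\<bar>"] S by (auto simp: y_def intro: order.trans)
    then have "y \<in> C K" by (auto simp: C_def abs_le_iff minus_le_iff)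
    moreover have "conv T = \<Psi> y"
    proof
      fix k
      show "conv T k = \<Psi> y k"
        using x[OF hI, of k] polyfun_cong[OF g[OF hI], of k x y]
        by (auto simp: conv_def \<Psi>_def y_def)
    qed
    ultimately show "T \<in> conv -` (\<Union>K. \<Psi> ` C K) \<inter> space (Pi\<^sub>M I (\<lambda>_. lborel))"
      using T by (auto simp: space_PiM)
  next
    fix T assume "T \<in> conv -` (\<Union>K. \<Psi> ` C K) \<inter> space (Pi\<^sub>M I (\<lambda>_. lborel))"
    then obtain x where T: "T \<in> (\<Pi>\<^sub>E i\<in>I. UNIV)" and x: "conv T = \<Psi> x"
      by (auto simp: space_PiM)
    have "T i = g i x" if i: "i \<in> I" for i
    proof -
      obtain k where "k < N" "i = h k" using h i by (auto simp: bij_betw_def)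
      then show ?thesis using fun_cong[OF x, of k] by (simp add: conv_def \<Psi>_def)
    qed
    then show "T \<in> poly_image I g" using T by (auto simp: poly_image_def)
  qed
  then show ?thesis using measurable_sets[OF conv meas] by simp
qed

section \<open>Null images of lower-dimensional parameter spaces\<close>

lemma emeasure_cube:
  assumes "finite I" "0 \<le> e"
  shows "emeasure (Pi\<^sub>M I (\<lambda>_. lborel)) (\<Pi>\<^sub>E i\<in>I. {c i - e..c i + e :: real}) = ennreal ((2 * e) ^ card I)"
proof -
  have "emeasure (Pi\<^sub>M I (\<lambda>_. lborel)) (\<Pi>\<^sub>E i\<in>I. {c i - e..c i + e})
    = (\<Prod>i\<in>I. emeasure lborel {c i - e..c i + e})"
    using assms(1) by (intro lborel_PiM.emeasure_PiM) auto
  also have "\<dots> = (\<Prod>i\<in>I. ennreal (2 * e))"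
    using assms(2) by (intro prod.cong) auto
  finally show ?thesis using assms by (simp add: ennreal_power)
qed

text \<open>The parameter cube is cut into cells of side \<open>1 / m\<close>, and the image of each cell lies in a cube of side
  \<open>2 L / m\<close>.\<close>

lemma poly_image_box_cover:
  fixes K m :: nat and g :: "'i \<Rightarrow> ('v \<Rightarrow> real) \<Rightarrow> real" and L :: real
  assumes I: "finite I" and S: "finite S" and card: "card S < card I"
    and L: "0 \<le> L" "\<And>i x y d. i \<in> I \<Longrightarrow> \<forall>v\<in>S. \<bar>x v\<bar> \<le> real K \<Longrightarrow> \<forall>v\<in>S. \<bar>y v\<bar> \<le> real K \<Longrightarrow>
      \<forall>v\<in>S. \<bar>x v - y v\<bar> \<le> d \<Longrightarrow> 0 \<le> d \<Longrightarrow> \<bar>g i x - g i y\<bar> \<le> L * d"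
    and "1 \<le> K" "1 \<le> m"
  obtains B where "B \<in> sets (Pi\<^sub>M I (\<lambda>_. lborel))"
    "emeasure (Pi\<^sub>M I (\<lambda>_. lborel)) B \<le> ennreal ((3 * K) ^ card S * (2 * L) ^ card I / m)"
    "\<And>x. \<forall>v\<in>S. \<bar>x v\<bar> \<le> real K \<Longrightarrow> restrict (\<lambda>i. g i x) I \<in> B"
proof -
  define M where "M = int (K * m)"
  define cells where "cells = (\<Pi>\<^sub>E v\<in>S. {- M..M})"
  define cell where "cell c = {x. (\<forall>v\<in>S. \<bar>x v\<bar> \<le> real K) \<and> (\<forall>v\<in>S. \<lfloor>x v * m\<rfloor> = c v)}" for c :: "'v \<Rightarrow> int"
  \<comment> \<open>Each nonempty cell gets a sample point; its box is centred at the image of that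
    point.\<close>
  define x0 where "x0 c = (SOME x. x \<in> cell c)" for c
  define box where "box c = (\<Pi>\<^sub>E i\<in>I. {g i (x0 c) - L / m..g i (x0 c) + L / m})" for c
  define B where "B = (\<Union>c\<in>cells. box c)"
  have m: "real m > 0" using assms by simp
  have fin: "finite cells" unfolding cells_def using S by (intro finite_PiE) auto
  have boxm: "box c \<in> sets (Pi\<^sub>M I (\<lambda>_. lborel))" for c
    unfolding box_def using I by (intro sets_PiM_I_finite) auto
  have "card cells = (2 * (K * m) + 1) ^ card S"
    unfolding cells_def using S by (simp add: card_PiE M_def nat_add_distrib nat_mult_distrib)
  also have "\<dots> \<le> (3 * (K * m)) ^ card S"
    using assms by (intro power_mono) auto
  finally have card_cells: "card cells \<le> (3 * (K * m)) ^ card S" .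
  have "emeasure (Pi\<^sub>M I (\<lambda>_. lborel)) B \<le> (\<Sum>c\<in>cells. emeasure (Pi\<^sub>M I (\<lambda>_. lborel)) (box c))"
    unfolding B_def using boxm by (intro emeasure_subadditive_finite fin) auto
  also have "\<dots> = (\<Sum>c\<in>cells. ennreal ((2 * (L / m)) ^ card I))"
    unfolding box_def using I L by (intro sum.cong refl emeasure_cube) auto
  also have "\<dots> = ennreal (card cells * (2 * (L / m)) ^ card I)"
    using L by (simp add: ennreal_mult ennreal_of_nat_eq_real_of_nat)
  also have "\<dots> \<le> ennreal ((3 * K) ^ card S * (2 * L) ^ card I / m)"
  proof (rule ennreal_leI)
    have "real (card cells) * (2 * (L / m)) ^ card I \<le> (3 * (K * m)) ^ card S * (2 * (L / m)) ^ card I"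
    proof (rule mult_right_mono)
      show "real (card cells) \<le> real ((3 * (K * m)) ^ card S)"
        using card_cells by (rule of_nat_mono)
    qed (use L in simp)
    also have "\<dots> = (3 * K) ^ card S * (2 * L) ^ card I * (real m ^ card S / real m ^ card I)"
      by (simp add: power_mult_distrib power_divide)
    \<comment> \<open>The cells number at most \<open>(3 * K * m) ^ card S\<close> and each box has
      volume \<open>(2 * L / m) ^ card I\<close>; as \<open>card S < card I\<close>, a factor
      \<open>1 / m\<close> remains.\<close>
    also have "real m ^ card S / real m ^ card I \<le> 1 / m"
    proof -
      have "real m ^ card S * real m \<le> real m ^ card I"
        using card assms power_increasing[of "Suc (card S)" "card I" "real m"] by (simp add: mult.commute)
      then show ?thesis using m by (simp add: field_simps)
    qed
    finally show "real (card cells) * (2 * (L / m)) ^ card I \<le> (3 * K) ^ card S * (2 * L) ^ card I / m"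
      using L by (simp add: mult_left_mono)
  qed
  finally have emB: "emeasure (Pi\<^sub>M I (\<lambda>_. lborel)) B \<le> ennreal ((3 * K) ^ card S * (2 * L) ^ card I / m)" .
  have cover: "restrict (\<lambda>i. g i x) I \<in> B" if x: "\<forall>v\<in>S. \<bar>x v\<bar> \<le> real K" for x
  proof -
    define c where "c = (\<lambda>v\<in>S. \<lfloor>x v * m\<rfloor>)"
    have "- M \<le> \<lfloor>x v * m\<rfloor> \<and> \<lfloor>x v * m\<rfloor> \<le> M" if "v \<in> S" for v
    proof -
      have "\<bar>x v * m\<bar> \<le> real (K * m)" using x that m by (simp add: abs_mult mult_right_mono)
      then have "- real (K * m) \<le> x v * m" "x v * m \<le> real (K * m)" by auto
      then show ?thesis unfolding M_def by (auto simp: le_floor_iff floor_le_iff)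
    qed
    then have c: "c \<in> cells" by (auto simp: c_def cells_def)
    have xc: "x \<in> cell c" using x by (auto simp: c_def cell_def)
    then have x0c: "x0 c \<in> cell c" unfolding x0_def by (rule someI[of "\<lambda>x. x \<in> cell c"])
    have "\<bar>x v - x0 c v\<bar> \<le> 1 / m" if v: "v \<in> S" for v
    proof -
      have "\<lfloor>x v * m\<rfloor> = \<lfloor>x0 c v * m\<rfloor>" using xc x0c v by (auto simp: cell_def)
      then have "\<bar>x v * m - x0 c v * m\<bar> \<le> 1" by linarith
      then have "\<bar>x v - x0 c v\<bar> * m \<le> 1" using m by (simp add: abs_mult flip: left_diff_distrib)
      then show ?thesis using m by (simp add: field_simps)
    qed
    then have "\<bar>g i x - g i (x0 c)\<bar> \<le> L * (1 / m)" if "i \<in> I" for i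
      using that x x0c m by (intro L(2)) (auto simp: cell_def)
    then have "restrict (\<lambda>i. g i x) I \<in> box c"
      unfolding box_def by (auto simp: abs_le_iff algebra_simps)
    then show ?thesis using c by (auto simp: B_def)
  qed
  show thesis
    by (rule that[OF _ emB cover]) (use boxm fin in \<open>auto simp: B_def\<close>)
qed

text \<open>The image of a bounded parameter cube has covers of measure at most \<open>C / m\<close>
  for every \<open>m\<close>, hence measure 0; countably many cubes exhaust the parameters.\<close>

lemma null_poly_image:
  assumes I: "finite I" and S: "finite S" and card: "card S < card I"
    and g: "\<And>i. i \<in> I \<Longrightarrow> polyfun S (g i)"
  shows "poly_image I g \<in> null_sets (Pi\<^sub>M I (\<lambda>_. lborel))"
proof -
  let ?P = "Pi\<^sub>M I (\<lambda>_. lborel :: real measure)"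
  have ex: "\<exists>N\<in>null_sets ?P. \<forall>x. (\<forall>v\<in>S. \<bar>x v\<bar> \<le> real K) \<longrightarrow> restrict (\<lambda>i. g i x) I \<in> N" if K: "1 \<le> K" for K :: nat
  proof -
    have "\<forall>i\<in>I. \<exists>L\<ge>0. \<forall>x y d. (\<forall>v\<in>S. \<bar>x v\<bar> \<le> real K) \<longrightarrow> (\<forall>v\<in>S. \<bar>y v\<bar> \<le> real K) \<longrightarrow>
      (\<forall>v\<in>S. \<bar>x v - y v\<bar> \<le> d) \<longrightarrow> 0 \<le> d \<longrightarrow> \<bar>g i x - g i y\<bar> \<le> L * d"
    proof
      fix i assume "i \<in> I"
      from g[OF this] show "\<exists>L\<ge>0. \<forall>x y d. (\<forall>v\<in>S. \<bar>x v\<bar> \<le> real K) \<longrightarrow> (\<forall>v\<in>S. \<bar>y v\<bar> \<le> real K) \<longrightarrow>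
        (\<forall>v\<in>S. \<bar>x v - y v\<bar> \<le> d) \<longrightarrow> 0 \<le> d \<longrightarrow> \<bar>g i x - g i y\<bar> \<le> L * d"
        by (rule polyfun_lipschitz[of S "g i" "real K"]) auto
    qed
    from bchoice[OF this] obtain Lf where Lf: "\<And>i. i \<in> I \<Longrightarrow> 0 \<le> Lf i"
      "\<And>i x y d. i \<in> I \<Longrightarrow> \<forall>v\<in>S. \<bar>x v\<bar> \<le> real K \<Longrightarrow> \<forall>v\<in>S. \<bar>y v\<bar> \<le> real K \<Longrightarrow>
      \<forall>v\<in>S. \<bar>x v - y v\<bar> \<le> d \<Longrightarrow> 0 \<le> d \<Longrightarrow> \<bar>g i x - g i y\<bar> \<le> Lf i * d" by blast
    \<comment> \<open>A common Lipschitz constant: the sum dominates each of its nonnegative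
      terms.\<close>
    define L where "L = (\<Sum>i\<in>I. Lf i)"
    have L: "0 \<le> L" using Lf(1) by (simp add: L_def sum_nonneg)
    have LfL: "Lf i \<le> L" if "i \<in> I" for i
      unfolding L_def using that Lf(1) I by (intro member_le_sum) auto
    have L2: "\<bar>g i x - g i y\<bar> \<le> L * d" if "i \<in> I" "\<forall>v\<in>S. \<bar>x v\<bar> \<le> real K" "\<forall>v\<in>S. \<bar>y v\<bar> \<le> real K"
      "\<forall>v\<in>S. \<bar>x v - y v\<bar> \<le> d" "0 \<le> d" for i x y d
      using Lf(2)[OF that] mult_right_mono[OF LfL[OF that(1)] that(5)] by linarith
    define C where "C = (3 * real K) ^ card S * (2 * L) ^ card I"
    have "\<forall>m::nat. \<exists>B\<in>sets ?P. emeasure ?P B \<le> ennreal (C / Suc m) \<and>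
       (\<forall>x. (\<forall>v\<in>S. \<bar>x v\<bar> \<le> real K) \<longrightarrow> restrict (\<lambda>i. g i x) I \<in> B)"
    proof
      fix m
      show "\<exists>B\<in>sets ?P. emeasure ?P B \<le> ennreal (C / Suc m) \<and>
       (\<forall>x. (\<forall>v\<in>S. \<bar>x v\<bar> \<le> real K) \<longrightarrow> restrict (\<lambda>i. g i x) I \<in> B)"
        by (rule poly_image_box_cover[where m = "Suc m", OF I S card L L2 K]) (auto simp: C_def)
    qed
    then obtain B where B: "\<And>m. B m \<in> sets ?P" "\<And>m::nat. emeasure ?P (B m) \<le> ennreal (C / Suc m)"
      "\<And>m x. \<forall>v\<in>S. \<bar>x v\<bar> \<le> real K \<Longrightarrow> restrict (\<lambda>i. g i x) I \<in> B m" by metis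
    have "emeasure ?P (\<Inter>m. B m) \<le> ennreal (C / Suc m)" for m
      using emeasure_mono[of "\<Inter>m. B m" "B m" ?P] B by (meson INT_lower UNIV_I order.trans)
    moreover have "(\<lambda>m. ennreal (C / Suc m)) \<longlonglongrightarrow> ennreal 0"
      by (intro tendsto_ennrealI tendsto_divide_0[OF tendsto_const] filterlim_compose[OF filterlim_real_sequentially filterlim_Suc] filterlim_at_top_imp_at_infinity)
    ultimately have "emeasure ?P (\<Inter>m. B m) \<le> ennreal 0"
      by (intro LIMSEQ_le_const) auto
    then have "(\<Inter>m. B m) \<in> null_sets ?P"
      using B(1) by (auto simp: null_sets_def)
    then show ?thesis using B(3) by (intro bexI[of _ "\<Inter>m. B m"]) auto
  qed
  \<comment> \<open>The radius is \<open>Suc K\<close> because the cubes treated above have radius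
    at least 1.\<close>
  define good where "good K N \<longleftrightarrow> N \<in> null_sets ?P \<and>
    (\<forall>x. (\<forall>v\<in>S. \<bar>x v\<bar> \<le> real (Suc K)) \<longrightarrow> restrict (\<lambda>i. g i x) I \<in> N)" for K N
  define N where "N K = (SOME N. good K N)" for K
  have "good K (N K)" for K
  proof -
    have "1 \<le> Suc K" by simp
    from ex[OF this] have "\<exists>N. good K N" unfolding good_def Bex_def .
    then show ?thesis unfolding N_def by (rule someI_ex)
  qed
  then have N: "\<And>K. N K \<in> null_sets ?P"
    "\<And>K x. \<forall>v\<in>S. \<bar>x v\<bar> \<le> real (Suc K) \<Longrightarrow> restrict (\<lambda>i. g i x) I \<in> N K"
    by (simp_all add: good_def)
  have null: "(\<Union>K. N K) \<in> null_sets ?P"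
    using N(1) by (intro null_sets_UN) auto
  have sub: "poly_image I g \<subseteq> (\<Union>K. N K)"
  proof
    fix T assume "T \<in> poly_image I g"
    then obtain x where T: "T \<in> (\<Pi>\<^sub>E i\<in>I. UNIV)" and x: "\<And>i. i \<in> I \<Longrightarrow> T i = g i x"
      by (auto simp: poly_image_def)
    obtain K :: nat where K: "(\<Sum>v\<in>S. \<bar>x v\<bar>) \<le> real K"
      using real_arch_simple by blast
    have "\<bar>x v\<bar> \<le> real (Suc K)" if "v \<in> S" for v
      using K member_le_sum[OF that, of "\<lambda>v. \<bar>x v\<bar>"] S by simp
    then have "restrict (\<lambda>i. g i x) I \<in> N K" by (intro N(2)) auto
    also have "restrict (\<lambda>i. g i x) I = T"
      using T x by (intro extensionalityI[of _ I]) (auto simp: PiE_iff)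
    finally show "T \<in> (\<Union>K. N K)" by blast
  qed
  have "poly_image I g \<in> sets ?P"
    by (rule measurable_poly_image[OF I g S])
  from null_sets_subset[OF null this sub] show ?thesis .
qed

section \<open>Determinants\<close>

text \<open>Entries are given by a function of two indices below \<open>n\<close>, so that they can
  depend polynomially on parameters and be pulled back along enumerations.\<close>

definition sqdet :: "nat \<Rightarrow> (nat \<Rightarrow> nat \<Rightarrow> real) \<Rightarrow> real" where
  "sqdet n A = Determinant.det (Matrix.mat n n (\<lambda>(i, j). A i j))"

lemma polyfun_sqdet:
  assumes "\<And>i j. i < n \<Longrightarrow> j < n \<Longrightarrow> polyfun I (\<lambda>x. A x i j)"
  shows "polyfun I (\<lambda>x. sqdet n (A x))"
proof -
  have "sqdet n (A x) = (\<Sum>p\<in>{p. p permutes {0..<n}}. signof p * (\<Prod>i = 0..<n. A x i (p i)))" for x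
    unfolding sqdet_def
    by (subst det_def'[of _ n]) (auto intro!: sum.cong prod.cong dest: permutes_in_image)
  moreover have "polyfun I (\<lambda>x. \<Sum>p\<in>{p. p permutes {0..<n}}. signof p * (\<Prod>i = 0..<n. A x i (p i)))"
  proof (intro polyfun_sum polyfun_mult polyfun_const polyfun_prod)
    fix p i assume "p \<in> {p. p permutes {0..<n}}" "i \<in> {0..<n}"
    then show "polyfun I (\<lambda>x. A x i (p i))"
      using permutes_in_image[of p "{0..<n}" i] by (intro assms) auto
  qed
  ultimately show ?thesis by simp
qed

lemma sqdet_identity:
  assumes "\<And>i j. i < n \<Longrightarrow> j < n \<Longrightarrow> A i j = (if i = j then 1 else 0)"
  shows "sqdet n A = 1"
proof -
  have "Matrix.mat n n (\<lambda>(i, j). A i j) = 1\<^sub>m n"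
    using assms by (intro eq_matI) auto
  then show ?thesis by (simp add: sqdet_def)
qed

lemma sqdet_nonzero_inverse:
  assumes "sqdet n A \<noteq> 0"
  obtains B where "\<And>i j. i < n \<Longrightarrow> j < n \<Longrightarrow> (\<Sum>k<n. A i k * B k j) = (if i = j then 1 else 0)"
proof -
  define M where "M = Matrix.mat n n (\<lambda>(i, j). A i j)"
  have M: "M \<in> carrier_mat n n" by (simp add: M_def)
  have d: "Determinant.det M \<noteq> 0" using assms by (simp add: sqdet_def M_def)
  note adj = adj_mat[OF M]
  define B where "B k j = adj_mat M $$ (k, j) / Determinant.det M" for k j
  have "(\<Sum>k<n. A i k * B k j) = (if i = j then 1 else 0)" if ij: "i < n" "j < n" for i j
  proof -
    have "(M * adj_mat M) $$ (i, j) = (\<Sum>k<n. A i k * adj_mat M $$ (k, j))"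
      using M adj(1) ij by (simp add: scalar_prod_def M_def lessThan_atLeast0)
    then have "(\<Sum>k<n. A i k * adj_mat M $$ (k, j)) = (if i = j then Determinant.det M else 0)"
      using adj(2) ij by (auto split: if_splits)
    moreover have "(\<Sum>k<n. A i k * B k j) = (\<Sum>k<n. A i k * adj_mat M $$ (k, j)) / Determinant.det M"
      by (simp add: B_def sum_divide_distrib)
    ultimately show ?thesis using d by simp
  qed
  then show thesis using that by blast
qed

text \<open>The array factors through dimension \<open>s < n\<close>. Padding both factors with
  zeros to size \<open>n\<close> makes the second one singular.\<close>

lemma sqdet_low_rank:
  assumes "s < n" "\<And>i j. i < n \<Longrightarrow> j < n \<Longrightarrow> A i j = (\<Sum>k<s. C i k * X k j)"
  shows "sqdet n A = 0"
proof -
  define M where "M = Matrix.mat n n (\<lambda>(i, k). if k < s then C i k else 0)"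
  define N where "N = Matrix.mat n n (\<lambda>(k, j). if k < s then X k j else 0)"
  have c: "M \<in> carrier_mat n n" "N \<in> carrier_mat n n" by (auto simp: M_def N_def)
  have "Matrix.mat n n (\<lambda>(i, j). A i j) = M * N"
  proof (rule eq_matI)
    fix i j assume "i < dim_row (M * N)" "j < dim_col (M * N)"
    then have ij: "i < n" "j < n" using c by auto
    have "(M * N) $$ (i, j) = (\<Sum>k<n. (if k < s then C i k else 0) * (if k < s then X k j else 0))"
      using ij by (simp add: M_def N_def scalar_prod_def lessThan_atLeast0)
    also have "\<dots> = (\<Sum>k<s. C i k * X k j)"
      using assms(1) by (intro sum.mono_neutral_cong_right) auto
    finally show "Matrix.mat n n (\<lambda>(i, j). A i j) $$ (i, j) = (M * N) $$ (i, j)"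
      using assms(2) ij by simp
  qed (use c in auto)
  then have "sqdet n A = Determinant.det M * Determinant.det N"
    using det_mult[OF c] by (simp add: sqdet_def)
  moreover have "Determinant.det N = 0"
  proof -
    \<comment> \<open>The last row of \<open>N\<close> is zero as \<open>s < n\<close>: scaling it
      by 0 leaves \<open>N\<close> unchanged but multiplies the determinant by 0.\<close>
    have "N = multrow (n - 1) 0 N"
      using assms(1) by (intro eq_matI) (auto simp: N_def)
    then have "Determinant.det N = 0 * Determinant.det N"
      using det_multrow[of "n - 1" n N 0] c(2) assms(1) by simp
    then show ?thesis by simp
  qed
  ultimately show ?thesis by simp
qed

text \<open>Each determinant is a polynomial in \<open>z\<close> with value 1 at a point that may
  depend on \<open>l\<close>. As nonzero polynomials have a common non-root, a single
  \<open>z\<close> makes all the matrices invertible, and \<open>W l\<close> is a right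
  inverse.\<close>

lemma polyfun_generic_invertible:
  fixes V :: "'l \<Rightarrow> ('v \<Rightarrow> real) \<Rightarrow> 'x \<Rightarrow> 'x \<Rightarrow> real"
  assumes X: "finite X" and L: "finite L"
    and V: "\<And>l j k. l \<in> L \<Longrightarrow> j \<in> X \<Longrightarrow> k \<in> X \<Longrightarrow> polyfun I (\<lambda>z. V l z j k)"
    and id: "\<And>l. l \<in> L \<Longrightarrow> \<exists>z. \<forall>j\<in>X. \<forall>k\<in>X. V l z j k = (if j = k then 1 else 0)"
  obtains z W where
    "\<And>l j j'. l \<in> L \<Longrightarrow> j \<in> X \<Longrightarrow> j' \<in> X \<Longrightarrow> (\<Sum>k\<in>X. V l z j k * W l k j') = (if j = j' then 1 else 0)"
proof -
  obtain h :: "nat \<Rightarrow> 'x" and N where h: "bij_betw h {..<N} X"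
    using ex_bij_betw_nat_finite[OF X] by (auto simp: lessThan_atLeast0)
  have hX: "h a \<in> X" if "a < N" for a using h that by (auto simp: bij_betw_def)
  have hinj: "h a = h b \<longleftrightarrow> a = b" if "a < N" "b < N" for a b
    using h that by (auto simp: bij_betw_def inj_on_def)
  define g where "g = the_inv_into {..<N} h"
  have g: "g j < N" "h (g j) = j" if "j \<in> X" for j
    using h that the_inv_into_into[of h "{..<N}" j] f_the_inv_into_f[of h "{..<N}" j]
    by (auto simp: g_def bij_betw_def)
  have gh: "g (h a) = a" if "a < N" for a using g[OF hX[OF that]] hinj that by blast
  define D where "D l z = sqdet N (\<lambda>a b. V l z (h a) (h b))" for l z
  have "\<exists>z. \<forall>l\<in>L. D l z \<noteq> 0"
  proof (rule polyfun_common_nonzero[OF L])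
    fix l assume l: "l \<in> L"
    show "polyfun I (D l)"
      unfolding D_def using V[OF l] hX by (intro polyfun_sqdet) auto
    obtain z where z: "\<And>j k. j \<in> X \<Longrightarrow> k \<in> X \<Longrightarrow> V l z j k = (if j = k then 1 else 0)"
      using id[OF l] by blast
    have "D l z = 1"
      unfolding D_def using z hX hinj by (intro sqdet_identity) auto
    then show "\<exists>z. D l z \<noteq> 0" by (intro exI[of _ z]) simp
  qed
  then obtain z where z: "\<And>l. l \<in> L \<Longrightarrow> D l z \<noteq> 0" by blast
  have "\<exists>W. \<forall>j\<in>X. \<forall>j'\<in>X. (\<Sum>k\<in>X. V l z j k * W k j') = (if j = j' then 1 else 0)" if l: "l \<in> L" for l
  proof -
    obtain B where B: "\<And>a b. a < N \<Longrightarrow> b < N \<Longrightarrow>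
        (\<Sum>k<N. V l z (h a) (h k) * B k b) = (if a = b then 1 else 0)"
      using sqdet_nonzero_inverse[OF z[OF l, unfolded D_def]] by blast
    have "(\<Sum>k\<in>X. V l z j k * B (g k) (g j')) = (if j = j' then 1 else 0)" if j: "j \<in> X" "j' \<in> X" for j j'
    proof -
      have "(\<Sum>k\<in>X. V l z j k * B (g k) (g j')) = (\<Sum>a<N. V l z j (h a) * B (g (h a)) (g j'))"
        by (rule sum.reindex_bij_betw[OF h, symmetric])
      also have "\<dots> = (\<Sum>a<N. V l z (h (g j)) (h a) * B a (g j'))"
        using g(2)[OF j(1)] gh by (intro sum.cong) auto
      also have "\<dots> = (if g j = g j' then 1 else 0)"
        using g(1) j by (intro B) auto
      also have "g j = g j' \<longleftrightarrow> j = j'" using g(2) j by metis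
      finally show ?thesis .
    qed
    then show ?thesis by (intro exI[of _ "\<lambda>k j'. B (g k) (g j')"]) blast
  qed
  then have "\<forall>l\<in>L. \<exists>W. \<forall>j\<in>X. \<forall>j'\<in>X. (\<Sum>k\<in>X. V l z j k * W k j') = (if j = j' then 1 else 0)"
    by blast
  then obtain W where "\<forall>l\<in>L. \<forall>j\<in>X. \<forall>j'\<in>X. (\<Sum>k\<in>X. V l z j k * W l k j') = (if j = j' then 1 else 0)"
    by (auto dest: bchoice)
  then show thesis using that[of z W] by blast
qed

section \<open>Sums of simple tensors\<close>

text \<open>All vectors are packed into one point \<open>x\<close>: the value at
  \<open>(k, i, c)\<close> is coordinate \<open>c\<close> of the \<open>i\<close>-th vector of
  summand \<open>k\<close>. Entries of the sum are thus polynomial functions of a single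
  point.\<close>

definition simple_sum :: "nat \<Rightarrow> nat \<Rightarrow> (nat \<Rightarrow> nat) \<Rightarrow> (nat \<times> nat \<times> nat \<Rightarrow> real) \<Rightarrow> real" where
  "simple_sum m r J x = (\<Sum>k<r. \<Prod>i=1..m. x (k, i, J i))"

definition params :: "nat \<Rightarrow> (nat \<Rightarrow> nat) \<Rightarrow> nat \<Rightarrow> (nat \<times> nat \<times> nat) set" where
  "params m p r = (SIGMA k:{..<r}. SIGMA i:{1..m}. {1..p i})"

lemma finite_params: "finite (params m p r)"
  by (simp add: params_def)

section \<open>Counting, extending and restricting multi-indices\<close>

lemma finite_multi_indices: "finite (multi_indices m p)"
  unfolding multi_indices_def by (intro finite_PiE) auto

lemma card_multi_indices: "card (multi_indices m p) = (\<Prod>i=1..m. p i)"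
  unfolding multi_indices_def by (simp add: card_PiE)

lemma multi_indices_mem: "J \<in> multi_indices m p \<Longrightarrow> i \<in> {1..m} \<Longrightarrow> J i \<in> {1..p i}"
  by (auto simp: multi_indices_def PiE_iff)

lemma multi_indices_extend:
  assumes "j \<in> multi_indices n p" "1 \<le> c" "c \<le> p (n + 1)"
  shows "j(n + 1 := c) \<in> multi_indices (n + 1) p"
  using assms by (auto simp: multi_indices_def PiE_iff extensional_def)

lemma multi_indices_restrict:
  "J \<in> multi_indices (n + 1) p \<Longrightarrow> restrict J {1..n} \<in> multi_indices n p"
  by (auto simp: multi_indices_def PiE_iff)

lemma multi_indices_split:
  assumes "J \<in> multi_indices (n + 1) p"
  shows "(restrict J {1..n})(n + 1 := J (n + 1)) = J"
proof
  fix i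
  show "((restrict J {1..n})(n + 1 := J (n + 1))) i = J i"
    using assms by (cases "i \<in> {1..n + 1}") (auto simp: multi_indices_def PiE_iff extensional_def)
qed

lemma multi_indices_extend_inject:
  assumes "j \<in> multi_indices n p" "j' \<in> multi_indices n p"
  shows "j(n + 1 := c) = j'(n + 1 := c') \<longleftrightarrow> j = j' \<and> c = c'"
proof
  assume *: "j(n + 1 := c) = j'(n + 1 := c')"
  have "j i = j' i" for i
    using fun_cong[OF *, of i] assms
    by (cases "i = n + 1") (auto simp: multi_indices_def PiE_iff extensional_def)
  moreover have "c = c'" using fun_cong[OF *, of "n + 1"] by simp
  ultimately show "j = j' \<and> c = c'" by auto
qed auto

lemma multi_indices_eqI:
  assumes "j \<in> multi_indices n p" "j' \<in> multi_indices n p" "\<And>i. i \<in> {1..n} \<Longrightarrow> j i = j' i"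
  shows "j = j'"
  using assms unfolding multi_indices_def by (rule PiE_ext)

lemma prod_indicator:
  "finite A \<Longrightarrow> (\<Prod>i\<in>A. if P i then 1 else 0 :: real) = (if \<forall>i\<in>A. P i then 1 else 0)"
  by (induction A rule: finite_induct) auto

section \<open>Rank bounds as membership in polynomial images\<close>

lemma polyfun_simple_sum:
  assumes "J \<in> multi_indices m p"
  shows "polyfun (params m p r) (simple_sum m r J)"
proof -
  have "polyfun (params m p r) (\<lambda>x. simple_sum m r J x)"
    unfolding simple_sum_def using multi_indices_mem[OF assms]
    by (intro polyfun_sum polyfun_prod polyfun_coord) (auto simp: params_def)
  then show ?thesis by simp
qed

lemma sum_of_simple_tensors_iff:
  "sum_of_simple_tensors m p r T \<longleftrightarrow> T \<in> poly_image (multi_indices m p) (simple_sum m r)"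
proof
  assume "sum_of_simple_tensors m p r T"
  then obtain a where T: "T = (\<lambda>j\<in>multi_indices m p. \<Sum>k<r. simple_tensor m p (a k) j)"
    by (auto simp: sum_of_simple_tensors_def)
  then show "T \<in> poly_image (multi_indices m p) (simple_sum m r)"
    unfolding poly_image_def
    by (auto intro!: exI[of _ "\<lambda>(k, i, c). a k i c"] simp: simple_sum_def simple_tensor_def)
next
  assume "T \<in> poly_image (multi_indices m p) (simple_sum m r)"
  then obtain x where T: "T \<in> (\<Pi>\<^sub>E i\<in>multi_indices m p. UNIV)"
    and x: "\<And>J. J \<in> multi_indices m p \<Longrightarrow> T J = simple_sum m r J x"
    by (auto simp: poly_image_def)
  have "T = (\<lambda>j\<in>multi_indices m p. \<Sum>k<r. simple_tensor m p (\<lambda>i c. x (k, i, c)) j)"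
    using T x by (intro extensionalityI[of _ "multi_indices m p"])
      (auto simp: PiE_iff simple_sum_def simple_tensor_def)
  then show "sum_of_simple_tensors m p r T"
    unfolding sum_of_simple_tensors_def by (rule exI[of _ "\<lambda>k i c. x (k, i, c)"])
qed

lemma sum_of_simple_tensors_mono:
  assumes "1 \<le> m" "r \<le> r'" "sum_of_simple_tensors m p r T"
  shows "sum_of_simple_tensors m p r' T"
proof -
  obtain x where T: "T \<in> (\<Pi>\<^sub>E i\<in>multi_indices m p. UNIV)"
    and x: "\<And>J. J \<in> multi_indices m p \<Longrightarrow> T J = simple_sum m r J x"
    using assms(3) by (auto simp: sum_of_simple_tensors_iff poly_image_def)
  \<comment> \<open>Zero vectors give zero summands because \<open>1 \<le> m\<close>; the empty
    product would be 1.\<close>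
  define y where "y = (\<lambda>(k, i, c). if k < r then x (k, i, c) else 0)"
  have "simple_sum m r' J y = simple_sum m r J x" for J
    unfolding simple_sum_def using assms(1,2)
    by (intro sum.mono_neutral_cong_right) (auto simp: y_def)
  with T x show ?thesis
    unfolding sum_of_simple_tensors_iff poly_image_def by (auto intro!: exI[of _ y])
qed

lemma tensor_rank_le_iff:
  assumes "1 \<le> m" "T \<in> tensor_space m p"
  shows "tensor_rank m p T \<le> r \<longleftrightarrow> sum_of_simple_tensors m p r T"
proof
  assume "tensor_rank m p T \<le> r"
  moreover have "sum_of_simple_tensors m p (tensor_rank m p T) T"
    unfolding tensor_rank_def using ex_sum_of_simple_tensors[OF assms] by (rule LeastI_ex)
  ultimately show "sum_of_simple_tensors m p r T"
    using sum_of_simple_tensors_mono[OF assms(1)] by blast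
qed (auto simp: tensor_rank_def intro: Least_le)

lemma rank_le_set:
  assumes "1 \<le> m"
  shows "{T \<in> tensor_space m p. tensor_rank m p T \<le> r} = poly_image (multi_indices m p) (simple_sum m r)"
  using tensor_rank_le_iff[OF assms, of _ p r]
  by (auto simp: sum_of_simple_tensors_iff poly_image_def tensor_space_def)

lemma not_typical_rank_if_null:
  assumes "1 \<le> m"
    and N: "N \<in> null_sets (Pi\<^sub>M (multi_indices m p) (\<lambda>_. lborel))"
    and sub: "poly_image (multi_indices m p) (simple_sum m r) \<subseteq> N"
  shows "\<not> typical_rank m p r"
proof -
  have "{T \<in> tensor_space m p. tensor_rank m p T = r} \<subseteq> N"
    using rank_le_set[OF assms(1), of p r] sub by auto
  then have "{T \<in> tensor_space m p. tensor_rank m p T = r} \<in> null_sets (tensor_lebesgue m p)"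
    unfolding tensor_lebesgue_def using N by (rule null_sets_completion_subset[OF _ null_sets_completionI])
  then show ?thesis by (simp add: typical_rank_def null_setsD1)
qed

text \<open>Removing the null set that holds all smaller ranks from the cube leaves tensors of rank
  exactly \<open>r\<close>, with the full volume of the cube.\<close>

lemma typical_rank_if_cube:
  assumes m: "1 \<le> m" and \<delta>: "0 < \<delta>"
    and box: "(\<Pi>\<^sub>E J\<in>multi_indices m p. {T0 J - \<delta>..T0 J + \<delta>}) \<subseteq> poly_image (multi_indices m p) (simple_sum m r)"
    and N: "N \<in> null_sets (Pi\<^sub>M (multi_indices m p) (\<lambda>_. lborel))"
    and sub: "\<And>r'. r' < r \<Longrightarrow> poly_image (multi_indices m p) (simple_sum m r') \<subseteq> N"
  shows "typical_rank m p r"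
proof -
  let ?I = "multi_indices m p"
  let ?P = "Pi\<^sub>M ?I (\<lambda>_. lborel :: real measure)"
  let ?A = "\<lambda>r. {T \<in> tensor_space m p. tensor_rank m p T \<le> r}"
  let ?B = "(\<Pi>\<^sub>E J\<in>?I. {T0 J - \<delta>..T0 J + \<delta>}) - N"
  have meas: "?A r \<in> sets ?P" for r
    unfolding rank_le_set[OF m]
    by (intro measurable_poly_image[OF finite_multi_indices polyfun_simple_sum finite_params])
  have "{T \<in> tensor_space m p. tensor_rank m p T = r} = ?A r - (\<Union>r'<r. ?A r')"
    by (auto, metis le_neq_implies_less lessThan_iff order_refl)
  with meas have rk: "{T \<in> tensor_space m p. tensor_rank m p T = r} \<in> sets ?P"
    by auto
  have sub': "?A r' \<subseteq> N" if "r' < r" for r'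
    unfolding rank_le_set[OF m] using sub[OF that] .
  have "?B \<subseteq> {T \<in> tensor_space m p. tensor_rank m p T = r}"
  proof
    fix T assume T: "T \<in> ?B"
    then have "T \<in> ?A r" unfolding rank_le_set[OF m] using box by blast
    moreover from this have "\<not> tensor_rank m p T < r" using T sub' by blast
    ultimately show "T \<in> {T \<in> tensor_space m p. tensor_rank m p T = r}" by auto
  qed
  then have "emeasure ?P ?B \<le> emeasure ?P {T \<in> tensor_space m p. tensor_rank m p T = r}"
    using rk by (rule emeasure_mono)
  moreover have "emeasure ?P ?B = ennreal ((2 * \<delta>) ^ card ?I)"
  proof -
    have "(\<Pi>\<^sub>E J\<in>?I. {T0 J - \<delta>..T0 J + \<delta>}) \<in> sets ?P"
      using finite_multi_indices by (intro sets_PiM_I_finite) auto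
    with N have "emeasure ?P ?B = emeasure ?P (\<Pi>\<^sub>E J\<in>?I. {T0 J - \<delta>..T0 J + \<delta>})"
      by (rule emeasure_Diff_null_set)
    also have "\<dots> = ennreal ((2 * \<delta>) ^ card ?I)"
      using \<delta> by (intro emeasure_cube finite_multi_indices) simp
    finally show ?thesis .
  qed
  ultimately have "ennreal ((2 * \<delta>) ^ card ?I) \<le> emeasure ?P {T \<in> tensor_space m p. tensor_rank m p T = r}"
    by simp
  moreover have "0 < ennreal ((2 * \<delta>) ^ card ?I)" using \<delta> by simp
  ultimately have "0 < emeasure ?P {T \<in> tensor_space m p. tensor_rank m p T = r}"
    by (rule less_le_trans[rotated])
  then show ?thesis
    using rk by (simp add: typical_rank_def tensor_lebesgue_def emeasure_completion)
qed

section \<open>Null sets from flattenings and from parameter counts\<close>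

lemma simple_sum_Suc:
  "simple_sum (n + 1) r J x = (\<Sum>k<r. x (k, n + 1, J (n + 1)) * (\<Prod>i=1..n. x (k, i, J i)))"
  by (simp add: simple_sum_def mult.commute)

text \<open>A sum of \<open>r'\<close> simple tensors has a flattening that factors through
  dimension \<open>r'\<close>. All ranks below \<open>p (n + 1)\<close> make the same minor vanish,
  so one null set serves for all of them.\<close>

lemma low_rank_null:
  assumes r: "p (n + 1) \<le> (\<Prod>i=1..n. p i)"
  obtains N where "N \<in> null_sets (Pi\<^sub>M (multi_indices (n + 1) p) (\<lambda>_. lborel))"
    "\<And>r'. r' < p (n + 1) \<Longrightarrow> poly_image (multi_indices (n + 1) p) (simple_sum (n + 1) r') \<subseteq> N"
proof -
  let ?I = "multi_indices (n + 1) p"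
  let ?P = "Pi\<^sub>M ?I (\<lambda>_. lborel :: real measure)"
  define r where "r = p (n + 1)"
  \<comment> \<open>Columns of the minor: distinct multi-indices of the first \<open>n\<close>
    factors, enough of which exist by the assumed bound.\<close>
  obtain h where h: "h ` {..<r} \<subseteq> multi_indices n p" "inj_on h {..<r}"
    using card_le_inj[of "{..<r}" "multi_indices n p"] assms
    by (auto simp: card_multi_indices finite_multi_indices r_def)
  define D where "D T = sqdet r (\<lambda>i j. T ((h j)(n + 1 := Suc i)))" for T :: "(nat \<Rightarrow> nat) \<Rightarrow> real"
  have idx: "(h j)(n + 1 := Suc i) \<in> ?I" if "i < r" "j < r" for i j
    using that h by (intro multi_indices_extend) (auto simp: r_def)
  have poly: "polyfun ?I D"
    unfolding D_def using idx by (intro polyfun_sqdet polyfun_coord)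
  \<comment> \<open>At this array the minor is the identity matrix; the shift by 1 arises because
    rows count from 0 and tensor coordinates from 1.\<close>
  define z where "z J = (if J = (h (J (n + 1) - 1))(n + 1 := J (n + 1)) then 1 else 0 :: real)" for J
  have "D z = 1"
    unfolding D_def
  proof (rule sqdet_identity)
    fix i j assume ij: "i < r" "j < r"
    have "h j \<in> multi_indices n p" "h i \<in> multi_indices n p" using h ij by auto
    from multi_indices_extend_inject[OF this, of "Suc i" "Suc i"]
    have "(h j)(n + 1 := Suc i) = (h i)(n + 1 := Suc i) \<longleftrightarrow> i = j"
      using h(2) ij by (auto simp: inj_on_def)
    then show "z ((h j)(n + 1 := Suc i)) = (if i = j then 1 else 0)"
      by (simp add: z_def)
  qed
  then have "AE T in ?P. D T \<noteq> 0"
    by (intro AE_polyfun_nonzero[OF finite_multi_indices poly, of z]) simp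
  then obtain N where N: "N \<in> null_sets ?P" "{T \<in> space ?P. \<not> D T \<noteq> 0} \<subseteq> N"
    by (auto elim!: AE_E simp: null_sets_def)
  have "poly_image ?I (simple_sum (n + 1) r') \<subseteq> N" if r': "r' < p (n + 1)" for r'
  proof
    fix T assume "T \<in> poly_image ?I (simple_sum (n + 1) r')"
    then obtain x where T: "T \<in> (\<Pi>\<^sub>E i\<in>?I. UNIV)"
      and x: "\<And>J. J \<in> ?I \<Longrightarrow> T J = simple_sum (n + 1) r' J x"
      by (auto simp: poly_image_def)
    have "D T = 0"
      unfolding D_def
    proof (rule sqdet_low_rank)
      show "r' < r" using r' by (simp add: r_def)
      show "T ((h j)(n + 1 := Suc i)) = (\<Sum>k<r'. x (k, n + 1, Suc i) * (\<Prod>i=1..n. x (k, i, h j i)))"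
        if "i < r" "j < r" for i j
        using x[OF idx[OF that]] unfolding simple_sum_Suc by simp
    qed
    then show "T \<in> N" using N(2) T by (auto simp: space_PiM)
  qed
  with N(1) show thesis using that by blast
qed

text \<open>The tensor is the sum, over the multi-indices of the first \<open>n\<close> factors, of
  the unit tensor at that index times the fibre of \<open>T\<close> along the last factor.\<close>

lemma tensor_rank_le_prod:
  assumes "T \<in> tensor_space (n + 1) p"
  shows "tensor_rank (n + 1) p T \<le> (\<Prod>i=1..n. p i)"
proof -
  let ?X = "multi_indices n p"
  define N where "N = (\<Prod>i=1..n. p i)"
  obtain h where h: "bij_betw h {..<N} ?X"
    using ex_bij_betw_nat_finite[OF finite_multi_indices, of n p]
    by (auto simp: lessThan_atLeast0 card_multi_indices N_def)
  define x where "x = (\<lambda>(k, i, c). if i = n + 1 then T ((h k)(n + 1 := c)) else if c = h k i then 1 else 0)"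
  have "T J = simple_sum (n + 1) N J x" if J: "J \<in> multi_indices (n + 1) p" for J
  proof -
    have rJ: "restrict J {1..n} \<in> ?X" using multi_indices_restrict[OF J] .
    have "simple_sum (n + 1) N J x =
      (\<Sum>k<N. T ((h k)(n + 1 := J (n + 1))) * (\<Prod>i=1..n. if J i = h k i then 1 else 0))"
      unfolding simple_sum_Suc by (intro sum.cong arg_cong2[of _ _ _ _ "(*)"] prod.cong) (auto simp: x_def)
    also have "\<dots> = (\<Sum>k<N. T ((h k)(n + 1 := J (n + 1))) * (if \<forall>i\<in>{1..n}. J i = h k i then 1 else 0))"
      by (simp add: prod_indicator)
    also have "\<dots> = (\<Sum>j\<in>?X. T (j(n + 1 := J (n + 1))) * (if \<forall>i\<in>{1..n}. J i = j i then 1 else 0))"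
      by (rule sum.reindex_bij_betw[OF h])
    also have "\<dots> = (\<Sum>j\<in>?X. if j = restrict J {1..n} then T (j(n + 1 := J (n + 1))) else 0)"
    proof (intro sum.cong refl)
      fix j assume j: "j \<in> ?X"
      have "(\<forall>i\<in>{1..n}. J i = j i) \<longleftrightarrow> j = restrict J {1..n}"
        using multi_indices_eqI[OF j rJ] by auto
      then show "T (j(n + 1 := J (n + 1))) * (if \<forall>i\<in>{1..n}. J i = j i then 1 else 0)
        = (if j = restrict J {1..n} then T (j(n + 1 := J (n + 1))) else 0)" by simp
    qed
    also have "\<dots> = T ((restrict J {1..n})(n + 1 := J (n + 1)))"
      using rJ finite_multi_indices by simp
    also have "\<dots> = T J" using multi_indices_split[OF J] by simp
    finally show ?thesis ..
  qed
  then have "sum_of_simple_tensors (n + 1) p N T"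
    using assms unfolding sum_of_simple_tensors_iff poly_image_def tensor_space_def by blast
  then show ?thesis using tensor_rank_le_iff[of "n + 1" T p N] assms by (simp add: N_def)
qed

text \<open>Scale the coordinate \<open>w (k, i)\<close> of the \<open>i\<close>-th vector of the \<open>k\<close>-th summand to 1 and let the last vector
  absorb the factors; a summand containing a zero vector gets the last vector 0.\<close>

lemma chart_cover:
  assumes p: "\<And>i. i \<in> {1..n} \<Longrightarrow> 1 \<le> p i"
    and T: "T \<in> poly_image (multi_indices (n + 1) p) (simple_sum (n + 1) r)"
  shows "\<exists>w\<in>(\<Pi>\<^sub>E (k, i)\<in>{..<r} \<times> {1..n}. {1..p i}).
    T \<in> poly_image (multi_indices (n + 1) p)
      (\<lambda>J y. \<Sum>k<r. y (k, n + 1, J (n + 1)) * (\<Prod>i=1..n. if J i = w (k, i) then 1 else y (k, i, J i)))"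
proof -
  obtain x where T: "T \<in> (\<Pi>\<^sub>E i\<in>multi_indices (n + 1) p. UNIV)"
    and x: "\<And>J. J \<in> multi_indices (n + 1) p \<Longrightarrow> T J = simple_sum (n + 1) r J x"
    using T by (auto simp: poly_image_def)
  define good where "good k \<longleftrightarrow> (\<forall>i\<in>{1..n}. \<exists>c\<in>{1..p i}. x (k, i, c) \<noteq> 0)" for k
  define c where "c k i = (SOME c. c \<in> {1..p i} \<and> x (k, i, c) \<noteq> 0)" for k i
  have c: "c k i \<in> {1..p i}" "x (k, i, c k i) \<noteq> 0" if "good k" "i \<in> {1..n}" for k i
  proof -
    have "\<exists>c. c \<in> {1..p i} \<and> x (k, i, c) \<noteq> 0" using that unfolding good_def by blast
    from someI_ex[OF this] show "c k i \<in> {1..p i}" "x (k, i, c k i) \<noteq> 0"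
      unfolding c_def by blast+
  qed
  \<comment> \<open>A summand with a zero vector has no coordinate to normalise; the value 1 is
    admissible since \<open>1 \<le> p i\<close>.\<close>
  define w where "w = (\<lambda>(k, i)\<in>{..<r} \<times> {1..n}. if good k then c k i else 1)"
  have "(if good k then c k i else 1) \<in> {1..p i}" if "i \<in> {1..n}" for k i
    using c(1)[OF _ that, of k] p[OF that] by simp
  then have w: "w \<in> (\<Pi>\<^sub>E (k, i)\<in>{..<r} \<times> {1..n}. {1..p i})"
    unfolding w_def by (intro restrict_PiE_iff[THEN iffD2]) auto
  define y where "y = (\<lambda>(k, i, a). if i = n + 1
      then if good k then x (k, n + 1, a) * (\<Prod>i=1..n. x (k, i, c k i)) else 0
      else x (k, i, a) / x (k, i, c k i))"
  have *: "x (k, n + 1, J (n + 1)) * (\<Prod>i=1..n. x (k, i, J i))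
     = y (k, n + 1, J (n + 1)) * (\<Prod>i=1..n. if J i = w (k, i) then 1 else y (k, i, J i))"
    if J: "J \<in> multi_indices (n + 1) p" and k: "k < r" for J k
  proof (cases "good k")
    case True
    have "(\<Prod>i=1..n. x (k, i, J i))
      = (\<Prod>i=1..n. x (k, i, c k i) * (if J i = w (k, i) then 1 else y (k, i, J i)))"
    proof (intro prod.cong refl)
      fix i assume i: "i \<in> {1..n}"
      have "w (k, i) = c k i" using k i True by (simp add: w_def)
      moreover have "y (k, i, J i) = x (k, i, J i) / x (k, i, c k i)" using i by (simp add: y_def)
      ultimately show "x (k, i, J i) = x (k, i, c k i) * (if J i = w (k, i) then 1 else y (k, i, J i))"
        using c(2)[OF True i] by simp
    qed
    then show ?thesis using True by (simp add: y_def prod.distrib)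
  next
    case False
    then obtain i where i: "i \<in> {1..n}" "\<forall>c\<in>{1..p i}. x (k, i, c) = 0"
      by (auto simp: good_def)
    then have "x (k, i, J i) = 0" using multi_indices_mem[OF J, of i] by auto
    then have "(\<Prod>i=1..n. x (k, i, J i)) = 0" using i(1) by (intro prod_zero) auto
    then show ?thesis using False by (simp add: y_def)
  qed
  have "T J = (\<Sum>k<r. y (k, n + 1, J (n + 1)) * (\<Prod>i=1..n. if J i = w (k, i) then 1 else y (k, i, J i)))"
    if "J \<in> multi_indices (n + 1) p" for J
    unfolding x[OF that] simple_sum_Suc by (intro sum.cong refl *[OF that]) simp
  then show ?thesis using T w by (intro bexI[of _ w]) (auto simp: poly_image_def)
qed

text \<open>Each of the finitely many charts has \<open>r * (s + r)\<close> parameters, with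
  \<open>s\<close> the sum of the \<open>p i - 1\<close>, against \<open>r\<close> times the product
  of the \<open>p i\<close> coordinates; so every chart has a null image.\<close>

lemma few_parameters_null:
  assumes p: "\<And>i. i \<in> {1..n} \<Longrightarrow> 1 \<le> p i"
    and r: "1 \<le> r" "(\<Sum>i=1..n. p i - 1) + p (n + 1) < (\<Prod>i=1..n. p i)" "r = p (n + 1)"
  shows "poly_image (multi_indices (n + 1) p) (simple_sum (n + 1) r)
    \<in> null_sets (Pi\<^sub>M (multi_indices (n + 1) p) (\<lambda>_. lborel))"
proof -
  let ?I = "multi_indices (n + 1) p"
  let ?P = "Pi\<^sub>M ?I (\<lambda>_. lborel :: real measure)"
  define W where "W = (\<Pi>\<^sub>E (k, i)\<in>{..<r} \<times> {1..n}. {1..p i})"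
  define g where "g w J y = (\<Sum>k<r. y (k, n + 1, J (n + 1)) *
      (\<Prod>i=1..n. if J i = w (k, i) then 1 else y (k, i, J i)))" for w and J :: "nat \<Rightarrow> nat" and y :: "nat \<times> nat \<times> nat \<Rightarrow> real"
  \<comment> \<open>The coordinates normalised by \<open>w\<close> are removed from the parameter
    set.\<close>
  define S where "S w = (SIGMA k:{..<r}. SIGMA i:{1..n + 1}. if i = n + 1 then {1..r} else {1..p i} - {w (k, i)})" for w
  have finS: "finite (S w)" for w by (auto simp: S_def)
  have "poly_image ?I (g w) \<in> null_sets ?P" if w: "w \<in> W" for w
  proof (rule null_poly_image[OF finite_multi_indices finS[of w]])
    have wm: "w (k, i) \<in> {1..p i}" if "k < r" "i \<in> {1..n}" for k i
      using w that by (auto simp: W_def PiE_iff)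
    have "card (S w) = (\<Sum>k<r. \<Sum>i=1..n + 1. card (if i = n + 1 then {1..r} else {1..p i} - {w (k, i)}))"
      by (simp add: S_def)
    also have "\<dots> = (\<Sum>k<r. (\<Sum>i=1..n. p i - 1) + r)"
      using wm by (intro sum.cong refl) (simp add: card_Diff_singleton)
    also have "\<dots> = r * ((\<Sum>i=1..n. p i - 1) + r)" by simp
    also have "\<dots> < r * (\<Prod>i=1..n. p i)" using r by simp
    also have "\<dots> = card ?I" using r(3) by (simp add: card_multi_indices)
    finally show "card (S w) < card ?I" .
    fix J assume J: "J \<in> ?I"
    have "polyfun (S w) (\<lambda>y. if J i = w (k, i) then 1 else y (k, i, J i))"
      if "k < r" "i \<in> {1..n}" for k i
      using multi_indices_mem[OF J, of i] that
      by (cases "J i = w (k, i)") (auto intro!: polyfun_const polyfun_coord simp: S_def)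
    moreover have "polyfun (S w) (\<lambda>y. y (k, n + 1, J (n + 1)))" if "k < r" for k
      using multi_indices_mem[OF J, of "n + 1"] that r(3) by (intro polyfun_coord) (auto simp: S_def)
    ultimately have "polyfun (S w) (\<lambda>y. g w J y)"
      unfolding g_def by (intro polyfun_sum polyfun_mult polyfun_prod) auto
    then show "polyfun (S w) (g w J)" by simp
  qed
  moreover have "finite W"
    unfolding W_def by (intro finite_PiE) auto
  ultimately have null: "(\<Union>w\<in>W. poly_image ?I (g w)) \<in> null_sets ?P"
    by (intro null_sets_UN') (auto intro: countable_finite)
  have sub: "poly_image ?I (simple_sum (n + 1) r) \<subseteq> (\<Union>w\<in>W. poly_image ?I (g w))"
  proof
    fix T assume "T \<in> poly_image ?I (simple_sum (n + 1) r)"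
    from chart_cover[OF p this] show "T \<in> (\<Union>w\<in>W. poly_image ?I (g w))"
      unfolding W_def g_def by blast
  qed
  have "poly_image ?I (simple_sum (n + 1) r) \<in> sets ?P"
    by (intro measurable_poly_image[OF finite_multi_indices polyfun_simple_sum finite_params])
  from null_sets_subset[OF null this sub] show ?thesis .
qed

section \<open>Typical ranks\<close>

text \<open>Column \<open>K\<close> of the matrix for a fixed \<open>l\<close> is the simple tensor number \<open>\<kappa> K\<close> if \<open>K \<in> R\<close>, and otherwise the tangent vector
  at \<open>x\<^sub>l\<close> in the direction of the coordinate \<open>K (\<iota> K)\<close> of the \<open>\<iota> K\<close>-th factor.\<close>

definition frame_entry :: "nat \<Rightarrow> (nat \<times> nat \<times> nat \<Rightarrow> real) \<Rightarrow> (nat \<Rightarrow> nat) set \<Rightarrow> ((nat \<Rightarrow> nat) \<Rightarrow> nat) \<Rightarrow>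
    ((nat \<Rightarrow> nat) \<Rightarrow> nat) \<Rightarrow> nat \<Rightarrow> (nat \<Rightarrow> nat) \<Rightarrow> (nat \<Rightarrow> nat) \<Rightarrow> real" where
  "frame_entry n z R \<iota> \<kappa> l J K =
     (if K \<in> R then \<Prod>i=1..n. z (\<kappa> K, i, J i)
      else (if J (\<iota> K) = K (\<iota> K) then 1 else 0) * (\<Prod>i\<in>{1..n} - {\<iota> K}. z (l, i, J i)))"

text \<open>The indices of the unit tensors spanning the tangent space at \<open>e\<^sub>1 \<otimes> \<cdots> \<otimes> e\<^sub>1\<close>.\<close>

definition cross :: "nat \<Rightarrow> (nat \<Rightarrow> nat) \<Rightarrow> (nat \<Rightarrow> nat) set" where
  "cross n p = {K \<in> multi_indices n p. \<exists>i\<in>{1..n}. \<forall>i'\<in>{1..n} - {i}. K i' = 1}"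

text \<open>The all-ones index and its modifications in one place already give one element more than
  the sum.\<close>

lemma card_cross:
  assumes n: "1 \<le> n" and p: "\<And>i. i \<in> {1..n} \<Longrightarrow> 1 \<le> p i"
  shows "(\<Sum>i=1..n. p i - 1) < card (cross n p)"
proof -
  \<comment> \<open>Values start at 2, so that a modified index determines the place and the value,
    and differs from the all-ones index.\<close>
  define A where "A = (SIGMA i:{1..n}. {2..p i})"
  define c0 where "c0 = (\<lambda>i\<in>{1..n}. 1 :: nat)"
  define f where "f = (\<lambda>(i, c). c0(i := c))"
  have c0: "c0 i = 1" if "i \<in> {1..n}" for i using that by (simp add: c0_def)
  have "inj_on f A"
  proof (rule inj_onI)
    fix a b assume a: "a \<in> A" and b: "b \<in> A" and "f a = f b"
    obtain i c i' c' where ab: "a = (i, c)" "b = (i', c')" by fastforce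
    have "(c0(i := c)) i = (c0(i' := c')) i" using \<open>f a = f b\<close> by (simp add: f_def ab)
    then show "a = b"
      using a b c0[of i] by (auto simp: ab A_def split: if_splits)
  qed
  then have "card (f ` A) = card A" by (rule card_image)
  moreover have "c0 \<notin> f ` A"
  proof
    assume "c0 \<in> f ` A"
    then obtain a where a: "a \<in> A" "c0 = f a" by blast
    obtain i c where ic: "a = (i, c)" by fastforce
    have "c0 i = c" using fun_cong[OF a(2), of i] by (simp add: f_def ic)
    then show False using c0[of i] a(1) by (simp add: A_def ic)
  qed
  moreover have "finite (f ` A)" by (simp add: A_def)
  ultimately have "card (insert c0 (f ` A)) = Suc (card A)" by simp
  moreover have "card A = (\<Sum>i=1..n. p i - 1)"
    by (simp add: A_def)
  moreover have "insert c0 (f ` A) \<subseteq> cross n p"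
  proof -
    have "c0 \<in> cross n p"
      using n p by (auto simp: cross_def multi_indices_def c0_def)
    moreover have "f a \<in> cross n p" if "a \<in> A" for a
    proof -
      obtain i c where ic: "a = (i, c)" by fastforce
      with that have a: "a = (i, c)" "i \<in> {1..n}" "2 \<le> c" "c \<le> p i"
        by (auto simp: A_def)
      have "c0(i := c) \<in> multi_indices n p"
        using a p by (auto simp: multi_indices_def c0_def PiE_iff extensional_def)
      moreover have "\<forall>i'\<in>{1..n} - {i}. (c0(i := c)) i' = 1" using c0 by simp
      ultimately show ?thesis using a(2) by (auto simp: cross_def f_def a(1))
    qed
    ultimately show ?thesis by auto
  qed
  moreover have "finite (cross n p)"
    using finite_multi_indices[of n p] by (simp add: cross_def)
  ultimately show ?thesis by (metis Suc_le_lessD card_mono)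
qed

text \<open>The indices in \<open>cross n p\<close> are served by tangent vectors at summand
  \<open>l\<close>. Fewer than \<open>r\<close> indices remain, so \<open>\<kappa> l\<close> can
  assign them distinct summands other than \<open>l\<close>. For each \<open>l\<close> some choice
  of unit vectors gives the identity matrix; a generic \<open>z\<close> then works for all
  \<open>l\<close> at once.\<close>

lemma tangent_frame:
  assumes n: "1 \<le> n" and p: "\<And>i. i \<in> {1..n} \<Longrightarrow> 1 \<le> p i"
    and r: "(\<Prod>i=1..n. p i) \<le> (\<Sum>i=1..n. p i - 1) + r"
  obtains z R \<iota> \<kappa> W where "R \<subseteq> multi_indices n p"
    "\<And>K. K \<in> multi_indices n p - R \<Longrightarrow> \<iota> K \<in> {1..n}"
    "\<And>l K. l < r \<Longrightarrow> K \<in> R \<Longrightarrow> \<kappa> l K < r"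
    "\<And>l J j. l < r \<Longrightarrow> J \<in> multi_indices n p \<Longrightarrow> j \<in> multi_indices n p \<Longrightarrow>
      (\<Sum>K\<in>multi_indices n p. frame_entry n z R \<iota> (\<kappa> l) l J K * W l K j) = (if J = j then 1 else 0)"
proof -
  let ?X = "multi_indices n p"
  define R where "R = ?X - cross n p"
  define \<iota> where "\<iota> K = (SOME i. i \<in> {1..n} \<and> (\<forall>i'\<in>{1..n} - {i}. K i' = (1::nat)))" for K
  have \<iota>: "\<iota> K \<in> {1..n}" "\<And>i'. i' \<in> {1..n} - {\<iota> K} \<Longrightarrow> K i' = 1" if "K \<in> ?X - R" for K
  proof -
    have "\<exists>i. i \<in> {1..n} \<and> (\<forall>i'\<in>{1..n} - {i}. K i' = 1)"
      using that unfolding R_def cross_def by blast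
    from someI_ex[OF this] show "\<iota> K \<in> {1..n}" "\<And>i'. i' \<in> {1..n} - {\<iota> K} \<Longrightarrow> K i' = 1"
      unfolding \<iota>_def by blast+
  qed
  have RX: "R \<subseteq> ?X" by (auto simp: R_def)
  have cR: "card R < r"
  proof -
    have "card R = card ?X - card (cross n p)"
      unfolding R_def using finite_multi_indices[of n p]
      by (intro card_Diff_subset) (auto simp: cross_def)
    then show ?thesis
      using card_cross[where p = p, OF n p] card_mono[of ?X "cross n p"] r
        finite_multi_indices[of n p] unfolding card_multi_indices by (auto simp: cross_def)
  qed
  \<comment> \<open>Summand \<open>l\<close> is reserved for the tangent vectors, and
    \<open>card R < r\<close> leaves room among the other \<open>r - 1\<close>.\<close>
  have "\<exists>\<kappa>. \<kappa> ` R \<subseteq> {..<r} - {l} \<and> inj_on \<kappa> R" if "l < r" for l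
    using card_le_inj[of R "{..<r} - {l}"] cR that finite_subset[OF RX finite_multi_indices] by auto
  then obtain \<kappa> where \<kappa>: "\<And>l. l < r \<Longrightarrow> \<kappa> l ` R \<subseteq> {..<r} - {l}" "\<And>l. l < r \<Longrightarrow> inj_on (\<kappa> l) R"
    by metis
  let ?V = "\<lambda>l z. frame_entry n z R \<iota> (\<kappa> l) l"
  obtain z W where zW: "\<And>l j j'. l \<in> {..<r} \<Longrightarrow> j \<in> ?X \<Longrightarrow> j' \<in> ?X \<Longrightarrow>
      (\<Sum>K\<in>?X. ?V l z j K * W l K j') = (if j = j' then 1 else 0)"
  proof (rule polyfun_generic_invertible[where I = UNIV and V = ?V and X = ?X and L = "{..<r}"])
    show "polyfun UNIV (\<lambda>z. ?V l z j K)" for l j K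
      unfolding frame_entry_def
      by (cases "K \<in> R") (auto intro!: polyfun_mult polyfun_prod polyfun_const polyfun_coord)
    fix l assume "l \<in> {..<r}"
    then have l: "l < r" by simp
    \<comment> \<open>Summand \<open>l\<close> is the unit tensor at the all-ones index, and summand
      \<open>\<kappa> l K\<close> is the unit tensor at \<open>K\<close>.\<close>
    define z where "z = (\<lambda>(k, i, c). if k = l then if c = 1 then 1 else 0
      else if c = the_inv_into R (\<kappa> l) k i then 1 else (0::real))"
    have "?V l z J K = (if J = K then 1 else 0)" if J: "J \<in> ?X" and K: "K \<in> ?X" for J K
    proof (cases "K \<in> R")
      case True
      have "\<kappa> l K \<noteq> l" "the_inv_into R (\<kappa> l) (\<kappa> l K) = K"
        using \<kappa>[OF l] True by (auto simp: the_inv_into_f_f)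
      then have "?V l z J K = (if \<forall>i\<in>{1..n}. J i = K i then 1 else 0)"
        using True by (simp add: frame_entry_def z_def prod_indicator)
      also have "(\<forall>i\<in>{1..n}. J i = K i) \<longleftrightarrow> J = K"
        using multi_indices_eqI[OF J K] by auto
      finally show ?thesis .
    next
      case False
      then have K': "K \<in> ?X - R" using K by simp
      have "?V l z J K = (if J (\<iota> K) = K (\<iota> K) then 1 else 0) *
        (if \<forall>i\<in>{1..n} - {\<iota> K}. J i = 1 then 1 else 0)"
        using False by (simp add: frame_entry_def z_def prod_indicator)
      also have "\<dots> = (if \<forall>i\<in>{1..n}. J i = K i then 1 else 0)"
      proof -
        have "(\<forall>i\<in>{1..n}. J i = K i) \<longleftrightarrow> J (\<iota> K) = K (\<iota> K) \<and> (\<forall>i\<in>{1..n} - {\<iota> K}. J i = K i)"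
          using \<iota>(1)[OF K'] by blast
        also have "(\<forall>i\<in>{1..n} - {\<iota> K}. J i = K i) \<longleftrightarrow> (\<forall>i\<in>{1..n} - {\<iota> K}. J i = 1)"
          using \<iota>(2)[OF K'] by (intro ball_cong) auto
        finally show ?thesis by simp
      qed
      also have "(\<forall>i\<in>{1..n}. J i = K i) \<longleftrightarrow> J = K"
        using multi_indices_eqI[OF J K] by auto
      finally show ?thesis .
    qed
    then show "\<exists>z. \<forall>j\<in>?X. \<forall>k\<in>?X. ?V l z j k = (if j = k then 1 else 0)" by blast
  qed (auto simp: finite_multi_indices)
  show thesis
  proof (rule that[of R \<iota> \<kappa> z W])
    show "\<kappa> l K < r" if "l < r" "K \<in> R" for l K using \<kappa>(1)[OF that(1)] that(2) by auto
  qed (use RX \<iota>(1) zW in auto)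
qed

text \<open>Composing the sum map with a linear right inverse \<open>dx\<close> of its derivative at
  \<open>x0\<close> gives a map \<open>G\<close> from the tensor space to itself with derivative the
  identity at 0. The local inverse argument then yields a cube around \<open>G\<close> at 0.\<close>

lemma cube_in_simple_sum_image:
  assumes n: "1 \<le> n" and p: "\<And>i. i \<in> {1..n} \<Longrightarrow> 1 \<le> p i"
    and r: "(\<Prod>i=1..n. p i) \<le> (\<Sum>i=1..n. p i - 1) + r" and rp: "r = p (n + 1)"
  obtains T0 \<delta> where "0 < \<delta>"
    "(\<Pi>\<^sub>E J\<in>multi_indices (n + 1) p. {T0 J - \<delta>..T0 J + \<delta>}) \<subseteq>
      poly_image (multi_indices (n + 1) p) (simple_sum (n + 1) r)"
proof -
  let ?X = "multi_indices n p" and ?I = "multi_indices (n + 1) p"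
  obtain z R \<iota> \<kappa> W where RX: "R \<subseteq> ?X" and \<iota>: "\<And>K. K \<in> ?X - R \<Longrightarrow> \<iota> K \<in> {1..n}"
    and \<kappa>: "\<And>l K. l < r \<Longrightarrow> K \<in> R \<Longrightarrow> \<kappa> l K < r"
    and W: "\<And>l J j. l < r \<Longrightarrow> J \<in> ?X \<Longrightarrow> j \<in> ?X \<Longrightarrow>
      (\<Sum>K\<in>?X. frame_entry n z R \<iota> (\<kappa> l) l J K * W l K j) = (if J = j then 1 else 0)"
    by (rule tangent_frame[where p = p, OF n p r]) (assumption, rule that, assumption+)
  have finR: "finite R" and finX: "finite ?X"
    using finite_multi_indices finite_subset[OF RX] by auto
  \<comment> \<open>The coefficients of slice \<open>l\<close> of \<open>y\<close>, the one with
    last index \<open>Suc l\<close>, in the frame belonging to \<open>l\<close>.\<close>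
  define u where "u l K y = (\<Sum>j\<in>?X. W l K j * y (j(n + 1 := Suc l)))" for l K and y :: "(nat \<Rightarrow> nat) \<Rightarrow> real"
  \<comment> \<open>The last vector of summand \<open>k\<close> is the unit vector at
    \<open>Suc k\<close>, since summands count from 0; all other vectors come from the generic
    \<open>z\<close>.\<close>
  define x0 where "x0 = (\<lambda>(k, i, c). if i = n + 1 then if c = Suc k then 1 else 0 else z (k, i, c))"
  \<comment> \<open>In slice \<open>l\<close>, the coefficient of the frame vector at
    \<open>K\<close> in \<open>R\<close> changes coordinate \<open>Suc l\<close> of the last vector
    of summand \<open>\<kappa> l K\<close>; the coefficient of a tangent vector changes coordinate
    \<open>K (\<iota> K)\<close> of vector \<open>\<iota> K\<close> of summand
    \<open>l\<close>.\<close>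
  define dx where "dx y = (\<lambda>(k, i, c). if i = n + 1 then \<Sum>K\<in>{K \<in> R. \<kappa> (c - 1) K = k}. u (c - 1) K y
      else \<Sum>K\<in>{K \<in> ?X - R. \<iota> K = i}. if K i = c then u k K y else 0)" for y
  define G where "G J y = simple_sum (n + 1) r J (\<lambda>v. x0 v + dx y v)" for J y
  have poly_u: "polyfun ?I (\<lambda>y. u l K y)" if "l < r" for l K
    unfolding u_def using that rp
    by (intro polyfun_sum polyfun_mult polyfun_const polyfun_coord multi_indices_extend) auto
  have poly_G: "polyfun ?I (G J)" if J: "J \<in> ?I" for J
  proof -
    have "polyfun ?I (\<lambda>y. x0 v + dx y v)" if v: "v \<in> params (n + 1) p r" for v
    proof -
      obtain k i c where v': "v = (k, i, c)" "k < r" "c \<in> {1..p i}"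
        using v by (auto simp: params_def)
      have "polyfun ?I (\<lambda>y. dx y v)"
      proof (cases "i = n + 1")
        case True
        then have "c - 1 < r" using v' rp by auto
        from poly_u[OF this] show ?thesis using True by (auto simp: v'(1) dx_def intro!: polyfun_sum)
      next
        case False
        have "polyfun ?I (\<lambda>y. if K i = c then u k K y else 0)" for K
          using poly_u[OF v'(2)] by (cases "K i = c") (auto intro: polyfun_const)
        then have "polyfun ?I (\<lambda>y. \<Sum>K\<in>{K \<in> ?X - R. \<iota> K = i}. if K i = c then u k K y else 0)"
          by (rule polyfun_sum)
        then show ?thesis using False by (simp add: v'(1) dx_def)
      qed
      then show ?thesis by (intro polyfun_add polyfun_const)
    qed
    from polyfun_compose[OF polyfun_simple_sum[OF J] this] show ?thesis
      by (simp add: G_def[abs_def])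
  qed
  have u_scale: "u l K (\<lambda>i. t * y i) = t * u l K y" for l K t y
    by (simp add: u_def sum_distrib_left algebra_simps)
  have dx_scale: "dx (\<lambda>i. t * y i) v = t * dx y v" for t y v
    by (auto simp: dx_def u_scale sum_distrib_left split: prod.split intro!: sum.cong)
  have deriv: "((\<lambda>t. G J (\<lambda>i. t * y i)) has_real_derivative y J) (at 0)" if J: "J \<in> ?I" for J y
  proof -
    define j where "j = restrict J {1..n}"
    have j: "j \<in> ?X" unfolding j_def using J by (rule multi_indices_restrict)
    define l where "l = J (n + 1) - 1"
    have Jl: "J (n + 1) = Suc l" and l: "l < r"
      using multi_indices_mem[OF J, of "n + 1"] rp by (auto simp: l_def)
    have jl: "j(n + 1 := Suc l) = J"
      unfolding j_def Jl[symmetric] using J by (rule multi_indices_split)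
    let ?Z = "\<lambda>k A. \<Prod>i\<in>A. z (k, i, J i)"
    \<comment> \<open>This is the product rule at \<open>t = 0\<close>; the terms with factor 0 come
      from evaluating there.\<close>
    define D where "D = (\<Sum>k<r. \<Sum>i\<in>{1..n + 1}. dx y (k, i, J i) *
        (\<Prod>i'\<in>{1..n + 1} - {i}. x0 (k, i', J i') + 0 * dx y (k, i', J i')))"
    have "((\<lambda>t. \<Sum>k<r. \<Prod>i\<in>{1..n + 1}. x0 (k, i, J i) + t * dx y (k, i, J i)) has_real_derivative D) (at 0)"
      unfolding D_def by (intro DERIV_sum has_field_derivative_prod) (auto intro!: derivative_eq_intros)
    then have "((\<lambda>t. G J (\<lambda>i. t * y i)) has_real_derivative D) (at 0)"
      by (simp add: G_def simple_sum_def dx_scale)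
    moreover have "D = y J"
    proof -
      have ins: "{1..n + 1} = insert (n + 1) {1..n}" by auto
      have x0z: "(\<Prod>i\<in>A. x0 (k, i, J i)) = ?Z k A" if "A \<subseteq> {1..n}" for k A
        using that by (intro prod.cong) (auto simp: x0_def)
      \<comment> \<open>Among the unperturbed last vectors only that of summand \<open>l\<close> is
        nonzero at \<open>Suc l\<close>, so variations of the first \<open>n\<close> vectors survive
        for \<open>k = l\<close> only.\<close>
      have "D = (\<Sum>k<r. dx y (k, n + 1, Suc l) * ?Z k {1..n} +
          (\<Sum>i=1..n. dx y (k, i, J i) * ((if l = k then 1 else 0) * ?Z k ({1..n} - {i}))))"
        unfolding D_def
      proof (intro sum.cong refl)
        fix k
        have 1: "insert (n + 1) {1..n} - {n + 1} = {1..n}" by auto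
        have 2: "(\<Prod>i'\<in>insert (n + 1) {1..n} - {i}. x0 (k, i', J i')) = (if l = k then 1 else 0) * ?Z k ({1..n} - {i})"
          if "i \<in> {1..n}" for i
        proof -
          have "insert (n + 1) {1..n} - {i} = insert (n + 1) ({1..n} - {i})" using that by auto
          then have "(\<Prod>i'\<in>insert (n + 1) {1..n} - {i}. x0 (k, i', J i'))
            = x0 (k, n + 1, J (n + 1)) * (\<Prod>i'\<in>{1..n} - {i}. x0 (k, i', J i'))"
            by (simp only:) (rule prod.insert; simp)
          also have "x0 (k, n + 1, J (n + 1)) = (if l = k then 1 else 0)"
            unfolding Jl by (simp add: x0_def)
          finally show ?thesis unfolding x0z[OF Diff_subset] .
        qed
        define F where "F i = dx y (k, i, J i) * (\<Prod>i'\<in>insert (n + 1) {1..n} - {i}. x0 (k, i', J i'))" for i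
        have "(\<Sum>i\<in>insert (n + 1) {1..n}. F i) = F (n + 1) + (\<Sum>i=1..n. F i)"
          by (rule sum.insert) auto
        moreover have "F (n + 1) = dx y (k, n + 1, Suc l) * ?Z k {1..n}"
          unfolding F_def 1 Jl x0z[OF subset_refl] ..
        moreover have "(\<Sum>i=1..n. F i) = (\<Sum>i=1..n. dx y (k, i, J i) * ((if l = k then 1 else 0) * ?Z k ({1..n} - {i})))"
          unfolding F_def by (intro sum.cong refl) (simp only: 2)
        ultimately show "(\<Sum>i\<in>{1..n + 1}. dx y (k, i, J i) *
            (\<Prod>i'\<in>{1..n + 1} - {i}. x0 (k, i', J i') + 0 * dx y (k, i', J i')))
          = dx y (k, n + 1, Suc l) * ?Z k {1..n} +
            (\<Sum>i=1..n. dx y (k, i, J i) * ((if l = k then 1 else 0) * ?Z k ({1..n} - {i})))"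
          unfolding ins mult_zero_left add_0_right F_def by (simp only:)
      qed
      also have "\<dots> = (\<Sum>k<r. dx y (k, n + 1, Suc l) * ?Z k {1..n}) +
          (\<Sum>k<r. if l = k then \<Sum>i=1..n. dx y (k, i, J i) * ?Z k ({1..n} - {i}) else 0)"
        unfolding sum.distrib by (intro arg_cong2[of _ _ _ _ "(+)"] refl sum.cong) auto
      also have "(\<Sum>k<r. if l = k then \<Sum>i=1..n. dx y (k, i, J i) * ?Z k ({1..n} - {i}) else 0)
        = (\<Sum>i=1..n. dx y (l, i, J i) * ?Z l ({1..n} - {i}))"
        using l by simp
      \<comment> \<open>Both parts are now sorted by frame columns: tangent columns by their
        direction \<open>\<iota> K\<close>, the columns in \<open>R\<close> by their summand
        \<open>\<kappa> l K\<close>.\<close>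
      also have "\<dots> = (\<Sum>i=1..n. \<Sum>K\<in>{K \<in> ?X - R. \<iota> K = i}. frame_entry n z R \<iota> (\<kappa> l) l J K * u l K y)"
        by (intro sum.cong refl) (auto simp: dx_def sum_distrib_right frame_entry_def intro!: sum.cong)
      also have "\<dots> = (\<Sum>K\<in>?X - R. frame_entry n z R \<iota> (\<kappa> l) l J K * u l K y)"
        using finX \<iota> by (intro sum.group) auto
      also have "(\<Sum>k<r. dx y (k, n + 1, Suc l) * ?Z k {1..n})
        = (\<Sum>k<r. \<Sum>K\<in>{K \<in> R. \<kappa> l K = k}. frame_entry n z R \<iota> (\<kappa> l) l J K * u l K y)"
        by (intro sum.cong refl) (auto simp: dx_def sum_distrib_right frame_entry_def intro!: sum.cong)
      also have "\<dots> = (\<Sum>K\<in>R. frame_entry n z R \<iota> (\<kappa> l) l J K * u l K y)"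
        using finR \<kappa>[OF l] by (intro sum.group) auto
      also have "(\<Sum>K\<in>R. frame_entry n z R \<iota> (\<kappa> l) l J K * u l K y) +
          (\<Sum>K\<in>?X - R. frame_entry n z R \<iota> (\<kappa> l) l J K * u l K y)
        = (\<Sum>K\<in>?X. frame_entry n z R \<iota> (\<kappa> l) l J K * u l K y)"
        by (subst sum.subset_diff[OF RX finX]) (rule add.commute)
      also have "\<dots> = (\<Sum>K\<in>?X. frame_entry n z R \<iota> (\<kappa> l) l j K * u l K y)"
      proof (intro sum.cong refl arg_cong2[of _ _ _ _ "(*)"])
        fix K assume K: "K \<in> ?X"
        have "j i = J i" if "i \<in> {1..n}" for i using that by (simp add: j_def)
        then show "frame_entry n z R \<iota> (\<kappa> l) l J K = frame_entry n z R \<iota> (\<kappa> l) l j K"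
          using \<iota>[of K] K unfolding frame_entry_def by (auto intro!: prod.cong)
      qed
      \<comment> \<open>Inserting \<open>u\<close> and exchanging sums brings out the frame matrix
        times its right inverse, which selects the entry of \<open>y\<close> at
        \<open>J\<close>.\<close>
      also have "\<dots> = (\<Sum>j'\<in>?X. (\<Sum>K\<in>?X. frame_entry n z R \<iota> (\<kappa> l) l j K * W l K j') * y (j'(n + 1 := Suc l)))"
        unfolding u_def sum_distrib_left sum_distrib_right
        by (subst sum.swap) (simp add: mult.assoc)
      also have "\<dots> = (\<Sum>j'\<in>?X. if j = j' then y (j'(n + 1 := Suc l)) else 0)"
        using W[OF l j] by (intro sum.cong refl) simp
      also have "\<dots> = y J" using finX j jl by simp
      finally show ?thesis .
    qed
    ultimately show ?thesis by simp
  qed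
  obtain \<delta> where \<delta>: "0 < \<delta>"
    "\<And>T. (\<And>J. J \<in> ?I \<Longrightarrow> \<bar>T J - G J (\<lambda>_. 0)\<bar> \<le> \<delta>) \<Longrightarrow> \<exists>y. \<forall>J\<in>?I. G J y = T J"
  proof (rule polyfun_local_inverse[where I = ?I and G = G])
    show "finite ?I" by (rule finite_multi_indices)
    show "polyfun ?I (G J)" if "J \<in> ?I" for J using that by (rule poly_G)
    show "((\<lambda>t. G J (\<lambda>i. t * y i)) has_real_derivative y J) (at 0)" if "J \<in> ?I" for J y
      using that by (rule deriv)
  qed (rule that, assumption, blast)
  have "T \<in> poly_image ?I (simple_sum (n + 1) r)"
    if T: "T \<in> (\<Pi>\<^sub>E J\<in>?I. {G J (\<lambda>_. 0) - \<delta>..G J (\<lambda>_. 0) + \<delta>})" for T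
  proof -
    have "\<bar>T J - G J (\<lambda>_. 0)\<bar> \<le> \<delta>" if "J \<in> ?I" for J
      using PiE_mem[OF T that] by (auto simp: abs_le_iff)
    then obtain y where "\<forall>J\<in>?I. G J y = T J" using \<delta>(2) by blast
    then have "\<forall>J\<in>?I. T J = simple_sum (n + 1) r J (\<lambda>v. x0 v + dx y v)" by (simp add: G_def)
    moreover have "T \<in> (\<Pi>\<^sub>E J\<in>?I. UNIV)" using T by (auto simp: PiE_iff)
    ultimately show ?thesis unfolding poly_image_def by blast
  qed
  then have "(\<Pi>\<^sub>E J\<in>?I. {G J (\<lambda>_. 0) - \<delta>..G J (\<lambda>_. 0) + \<delta>}) \<subseteq> poly_image ?I (simple_sum (n + 1) r)"
    by (rule subsetI)
  from that[OF \<delta>(1) this] show thesis .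
qed

theorem theorem1p1:
  fixes n :: nat and p :: "nat \<Rightarrow> nat" and q :: int
  assumes "2 \<le> n"
    and "2 \<le> p 1"
    and "mono_on {1..n} p"
    and "1 \<le> p (n + 1)"
    and "q = (\<Prod>i=1..n. int (p i)) - (\<Sum>i=1..n. int (p i)) + int n"
  shows "(q \<le> int (p (n + 1)) \<and> p (n + 1) \<le> (\<Prod>i=1..n. p i) \<longrightarrow>
            typical_rank (n + 1) p (p (n + 1)) \<and>
            (\<forall>r. typical_rank (n + 1) p r \<longrightarrow> p (n + 1) \<le> r) \<and>
            perfect_format (n + 1) p) \<and>
         (p n \<le> p (n + 1) \<and> perfect_format (n + 1) p \<longrightarrow>
            q \<le> int (p (n + 1)) \<and> p (n + 1) \<le> (\<Prod>i=1..n. p i))"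
proof -
  let ?I = "multi_indices (n + 1) p" and ?r = "p (n + 1)"
  let ?P = "\<Prod>i=1..n. p i" and ?s = "\<Sum>i=1..n. p i - 1"
  have n: "1 \<le> n" using assms(1) by simp
  have p2: "2 \<le> p i" if "i \<in> {1..n}" for i
    using mono_onD[OF assms(3), of 1 i] assms(2) that n by auto
  have pn: "p i \<le> p n" if "i \<in> {1..n}" for i
    using mono_onD[OF assms(3), of i n] that n by auto
  have p1: "1 \<le> p i" if "i \<in> {1..n}" for i using p2[OF that] by simp
  have "int ?s = (\<Sum>i=1..n. int (p i) - 1)"
    unfolding of_nat_sum using p1 by (intro sum.cong refl) (auto simp: of_nat_diff)
  \<comment> \<open>Hence \<open>q \<le> int ?r\<close> amounts to \<open>?P \<le> ?s + ?r\<close>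
    in natural numbers.\<close>
  then have q: "q = int ?P - int ?s"
    using assms(5) by (simp add: sum_subtractf)
  have Max: "Max (p ` {1..n + 1}) = ?r" if "p n \<le> ?r"
  proof (rule Max_eqI)
    fix y assume "y \<in> p ` {1..n + 1}"
    then obtain i where "y = p i" "i \<in> {1..n} \<or> i = n + 1" by (auto simp: le_Suc_eq)
    then show "y \<le> ?r" using pn[of i] that by auto
  qed auto
  \<comment> \<open>The lower bound on the last dimension makes it the maximum of the format, as
    \<open>perfect_format\<close> requires: it is shown that \<open>p n \<le> q\<close>.\<close>
  have pn_le: "p n \<le> ?r" if "q \<le> int ?r"
  proof -
    have split: "{1..n} = insert n {1..n - 1}" using n by auto
    \<comment> \<open>Counting \<open>cross\<close> inside all multi-indices shows that the product
      of the first \<open>n - 1\<close> dimensions exceeds the sum of the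
      \<open>p i - 1\<close>.\<close>
    have "card (cross (n - 1) p) \<le> (\<Prod>i=1..n - 1. p i)"
      unfolding card_multi_indices[symmetric] using finite_multi_indices[of "n - 1" p]
      by (intro card_mono) (auto simp: cross_def)
    moreover have "(\<Sum>i=1..n - 1. p i - 1) < card (cross (n - 1) p)"
      using assms(1) p1 by (intro card_cross) auto
    ultimately obtain d where d: "(\<Prod>i=1..n - 1. p i) = (\<Sum>i=1..n - 1. p i - 1) + 1 + d"
      by (metis Suc_eq_plus1 Suc_leI le_trans le_Suc_ex)
    have "1 \<le> (\<Sum>i=1..n - 1. p i - 1)"
    proof -
      have "p 1 - 1 \<le> (\<Sum>i=1..n - 1. p i - 1)"
        using assms(1) by (intro member_le_sum) auto
      then show ?thesis using assms(2) by simp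
    qed
    \<comment> \<open>With \<open>a\<close> for the sum over the first \<open>n - 1\<close> factors,
      the claim is \<open>a + 2 * p n - 1 \<le> p n * (a + 1 + d)\<close>; it holds because
      \<open>1 \<le> a\<close> and \<open>2 \<le> p n\<close>.\<close>
    then have "?s + p n \<le> ?P"
    proof -
      define a where "a = (\<Sum>i=1..n - 1. p i - 1)"
      obtain m where m: "p n = m + 2" using p2[of n] n by (auto simp: le_iff_add add.commute)
      have "?s = p n - 1 + a" unfolding split a_def using n by simp
      moreover have "?P = p n * (a + 1 + d)" unfolding split using n d by (simp add: a_def)
      moreover obtain b where "a = Suc b"
        using \<open>1 \<le> (\<Sum>i=1..n - 1. p i - 1)\<close> by (cases a) (simp_all add: a_def)
      ultimately show ?thesis by (simp add: m algebra_simps)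
    qed
    then show ?thesis using that q by linarith
  qed
  have fwd: "typical_rank (n + 1) p ?r \<and> (\<forall>r. typical_rank (n + 1) p r \<longrightarrow> ?r \<le> r) \<and> perfect_format (n + 1) p"
    if le: "q \<le> int ?r" "?r \<le> ?P"
  proof -
    obtain N where N: "N \<in> null_sets (Pi\<^sub>M ?I (\<lambda>_. lborel))"
      "\<And>r'. r' < ?r \<Longrightarrow> poly_image ?I (simple_sum (n + 1) r') \<subseteq> N"
      using low_rank_null[OF le(2)] by blast
    have large: "?P \<le> ?s + ?r" using le(1) q by linarith
    obtain T0 \<delta> where cube: "0 < \<delta>"
      "(\<Pi>\<^sub>E J\<in>?I. {T0 J - \<delta>..T0 J + \<delta>}) \<subseteq> poly_image ?I (simple_sum (n + 1) ?r)"
      by (rule cube_in_simple_sum_image[where p = p, OF n p1 large refl]) (assumption, rule that, assumption+)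
    have typical: "typical_rank (n + 1) p ?r"
      by (rule typical_rank_if_cube[OF _ cube N]) auto
    moreover have "?r \<le> r" if "typical_rank (n + 1) p r" for r
      using not_typical_rank_if_null[OF _ N(1) N(2)[of r]] that by fastforce
    ultimately show ?thesis
      using Max[OF pn_le[OF le(1)]] by (simp add: perfect_format_def)
  qed
  have bwd: "q \<le> int ?r \<and> ?r \<le> ?P" if pnr: "p n \<le> ?r" and perf: "perfect_format (n + 1) p"
  proof -
    have typical: "typical_rank (n + 1) p ?r"
      using perf unfolding perfect_format_def Max[OF pnr] .
    have "?r \<le> ?P"
    proof (rule ccontr)
      assume "\<not> ?r \<le> ?P"
      then have "{T \<in> tensor_space (n + 1) p. tensor_rank (n + 1) p T = ?r} = {}"
        using tensor_rank_le_prod[of _ n p] by fastforce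
      with typical show False by (simp only: typical_rank_def emeasure_empty less_irrefl)
    qed
    moreover have "q \<le> int ?r"
    proof (rule ccontr)
      assume "\<not> q \<le> int ?r"
      then have "?s + ?r < ?P" using q by linarith
      from few_parameters_null[where p = p, OF p1 assms(4) this refl]
      have "\<not> typical_rank (n + 1) p ?r"
        by (intro not_typical_rank_if_null[OF _ _ subset_refl]) auto
      with typical show False by blast
    qed
    ultimately show ?thesis by blast
  qed
  show ?thesis using fwd bwd by blast
qed

end
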